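(* Let $D\subseteq\mathbb{C}_\infty$ be a domain, let $\mathcal{F}\subseteq\mathcal{M}(D)$ and let $\epsilon>0$. Suppose that to each $f\in\mathcal{F}$ there are associated three functions $a_{1f},a_{2f},a_{3f}\in\mathcal{M}(D)\cup\{\infty\}$ such that $$\sigma(a_{jf}(z),a_{kf}(z))\geq\epsilon\quad\text{for all } j\neq k \text{ in } \{1,2,3\} \text{ and all } z\in D .$$ Suppose further that for every pair $f,g\in\mathcal{F}$ and every $j\in\{1,2,3\}$, the functions $f-a_{jf}$ and $g-a_{jg}$ share $0$ in $D$. Then $\mathcal{F}$ is normal in $D$.
   Context: $\mathbb{C}_\infty=\mathbb{C}\cup\{\infty\}$ is the Riemann sphere and $\sigma$ is the spherical metric on it (great-circle distance on the unit sphere, so the diameter is $\pi$). $\mathcal{M}(D)$ is the class of all meromorphic functions on the domain $D$, regarded as maps into $\mathbb{C}_\infty$, and $\mathcal{M}(D)\cup\{\infty\}$ also includes the function identically equal to $\infty$. A family $\mathcal{F}\subseteq\mathcal{M}(D)$ is normal on $D$ if every sequence in $\mathcal{F}$ has a subsequence converging locally uniformly on $D$ with respect to $\sigma$ to a limit function which is either meromorphic on $D$ or identically $\infty$. For $f\in\mathcal{M}(D)$ and $a\in\mathcal{M}(D)\cup\{\infty\}$, a zero of $f-a$ means a point $z\in D$ with $f(z)=a(z)$ in $\mathbb{C}_\infty$ (so points where both take the value $\infty$ are included). "$f-a$ and $g-b$ share $0$ in $D$" means that they have the same set of zeros in $D$, ignoring multiplicities: for $z\in D$, $f(z)=a(z)$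 if and only if $g(z)=b(z)$. *)

theory Defs
  imports "HOL-Complex_Analysis.Complex_Analysis"
begin

section \<open>The Riemann sphere with the spherical metric\<close>

datatype riemann_sphere = Finite complex | Infty

text \<open>Inverse of the stereographic projection from the north pole \<open>(0, 1)\<close> of the unit sphere in
  \<open>complex \<times> real\<close>.\<close>

primrec to_unit_sphere :: "riemann_sphere \<Rightarrow> complex \<times> real" where
  "to_unit_sphere (Finite z) =
     ((2 / ((cmod z)\<^sup>2 + 1)) *\<^sub>R z, ((cmod z)\<^sup>2 - 1) / ((cmod z)\<^sup>2 + 1))"
| "to_unit_sphere Infty = (0, 1)"

lemma norm_to_unit_sphere: "norm (to_unit_sphere x) = 1"
proof (cases x)
  case (Finite z)
  define t where "t = (cmod z)\<^sup>2"
  have t: "t \<ge> 0" by (simp add: t_def)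
  have "(norm (to_unit_sphere x))\<^sup>2 = (2 / (t + 1))\<^sup>2 * t + ((t - 1) / (t + 1))\<^sup>2"
    using t unfolding Finite to_unit_sphere.simps norm_Pair norm_scaleR t_def[symmetric]
    by (simp add: power_mult_distrib power_divide t_def)
  also have "\<dots> = (4 * t + (t - 1)\<^sup>2) / (t + 1)\<^sup>2"
    by (simp add: power_divide add_divide_distrib)
  also have "4 * t + (t - 1)\<^sup>2 = (t + 1)\<^sup>2"
    by (simp add: power2_eq_square algebra_simps)
  finally show ?thesis
    using t by (simp add: power2_eq_1_iff) (smt (verit) norm_ge_zero)
qed (simp add: norm_Pair)

lemma inj_to_unit_sphere: "inj to_unit_sphere"
proof (rule injI)
  fix x y assume eq: "to_unit_sphere x = to_unit_sphere y"
  have height: "snd (to_unit_sphere (Finite z)) = 1 - 2 / ((cmod z)\<^sup>2 + 1)" for z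
  proof -
    have "(cmod z)\<^sup>2 + 1 \<noteq> 0" by (smt (verit) zero_le_power2)
    then show ?thesis by (simp add: field_simps)
  qed
  have pos: "(cmod z)\<^sup>2 + 1 > 0" for z by (smt (verit) zero_le_power2)
  show "x = y"
  proof (cases x; cases y)
    fix z w assume x: "x = Finite z" and y: "y = Finite w"
    have "2 / ((cmod z)\<^sup>2 + 1) = 2 / ((cmod w)\<^sup>2 + 1)"
      using height[of z] height[of w] eq[THEN arg_cong[where f = snd]] unfolding x y by linarith
    moreover have "(2 / ((cmod z)\<^sup>2 + 1)) *\<^sub>R z = (2 / ((cmod w)\<^sup>2 + 1)) *\<^sub>R w"
      using eq by (simp add: x y)
    moreover have "2 / ((cmod w)\<^sup>2 + 1) \<noteq> 0" using pos[of w] by simp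
    ultimately show ?thesis by (metis scaleR_cancel_left x y)
  next
    fix z assume x: "x = Finite z" and y: "y = Infty"
    have "2 / ((cmod z)\<^sup>2 + 1) = 0"
      using height[of z] eq unfolding x y by simp
    then show ?thesis using pos[of z] by simp
  next
    fix w assume x: "x = Infty" and y: "y = Finite w"
    have "2 / ((cmod w)\<^sup>2 + 1) = 0"
      using height[of w] eq unfolding x y by simp
    then show ?thesis using pos[of w] by simp
  qed simp
qed

lemma arccos_inner_triangle:
  fixes u v w :: "'a::real_inner"
  assumes "norm u = 1" "norm v = 1" "norm w = 1"
  shows "arccos (u \<bullet> w) \<le> arccos (u \<bullet> v) + arccos (v \<bullet> w)"
proof -
  have bnd: "\<bar>a \<bullet> b\<bar> \<le> 1" if "norm a = 1" "norm b = 1" for a b :: 'a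
    using Cauchy_Schwarz_ineq2[of a b] that by simp
  have uv: "\<bar>u \<bullet> v\<bar> \<le> 1" and vw: "\<bar>v \<bullet> w\<bar> \<le> 1" and uw: "\<bar>u \<bullet> w\<bar> \<le> 1"
    using bnd assms by auto
  define \<alpha> \<beta> where "\<alpha> = arccos (u \<bullet> v)" and "\<beta> = arccos (v \<bullet> w)"
  have rng: "0 \<le> \<alpha>" "0 \<le> \<beta>"
    unfolding \<alpha>_def \<beta>_def using uv vw by (auto intro!: arccos_lbound)
  show ?thesis
  proof (cases "\<alpha> + \<beta> \<le> pi")
    case False
    moreover have "arccos (u \<bullet> w) \<le> pi" using uw by (intro arccos_ubound) auto
    ultimately show ?thesis unfolding \<alpha>_def \<beta>_def by linarith
  next
    case True
    have self: "a \<bullet> a = 1" if "norm a = 1" for a :: 'a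
      using that by (simp add: dot_square_norm)
    define p q where "p = u - (u \<bullet> v) *\<^sub>R v" and "q = w - (v \<bullet> w) *\<^sub>R v"
    have pq: "p \<bullet> q = u \<bullet> w - (u \<bullet> v) * (v \<bullet> w)"
      unfolding p_def q_def using self[OF assms(2)]
      by (simp add: inner_diff_left inner_diff_right inner_commute algebra_simps)
    have np: "norm p = sqrt (1 - (u \<bullet> v)\<^sup>2)"
      unfolding norm_eq_sqrt_inner p_def using self[OF assms(2)] self[OF assms(1)]
      by (simp add: inner_diff_left inner_diff_right inner_commute algebra_simps power2_eq_square)
    have nq: "norm q = sqrt (1 - (v \<bullet> w)\<^sup>2)"
      unfolding norm_eq_sqrt_inner q_def using self[OF assms(2)] self[OF assms(3)]
      by (simp add: inner_diff_left inner_diff_right inner_commute algebra_simps power2_eq_square)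
    have "cos (\<alpha> + \<beta>) = (u \<bullet> v) * (v \<bullet> w) - norm p * norm q"
      unfolding cos_add np nq \<alpha>_def \<beta>_def using uv vw
      by (simp add: cos_arccos_abs sin_arccos_abs)
    also have "\<dots> \<le> u \<bullet> w"
      using Cauchy_Schwarz_ineq2[of p q] pq by linarith
    finally have "arccos (u \<bullet> w) \<le> arccos (cos (\<alpha> + \<beta>))"
      using uw by (intro arccos_le_arccos) auto
    also have "\<dots> = \<alpha> + \<beta>" using True rng by (intro arccos_cos) auto
    finally show ?thesis by (simp add: \<alpha>_def \<beta>_def)
  qed
qed

text \<open>The distance is the great-circle distance between the corresponding points of the unit sphere;
  open sets, connectedness and uniform convergence on the sphere all refer to it.\<close>

instantiation riemann_sphere :: metric_space
begin

definition dist_riemann_sphere :: "riemann_sphere \<Rightarrow> riemann_sphere \<Rightarrow> real" where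
  "dist_riemann_sphere x y = arccos (to_unit_sphere x \<bullet> to_unit_sphere y)"

definition uniformity_riemann_sphere :: "(riemann_sphere \<times> riemann_sphere) filter" where
  "uniformity_riemann_sphere = (INF e\<in>{0<..}. principal {(x, y). dist x y < e})"

definition open_riemann_sphere :: "riemann_sphere set \<Rightarrow> bool" where
  "open_riemann_sphere U \<longleftrightarrow>
     (\<forall>x\<in>U. eventually (\<lambda>(x', y). x' = x \<longrightarrow> y \<in> U) uniformity)"

instance
proof
  fix x y z :: riemann_sphere
  have bnd: "\<bar>to_unit_sphere x \<bullet> to_unit_sphere y\<bar> \<le> 1"
    using Cauchy_Schwarz_ineq2[of "to_unit_sphere x" "to_unit_sphere y"]
    by (simp add: norm_to_unit_sphere)
  show "dist x y = 0 \<longleftrightarrow> x = y"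
  proof
    assume "dist x y = 0"
    then have "to_unit_sphere x \<bullet> to_unit_sphere y = 1"
      using cos_arccos_abs[OF bnd] by (simp add: dist_riemann_sphere_def)
    then have "(norm (to_unit_sphere x - to_unit_sphere y))\<^sup>2 = 0"
      using norm_to_unit_sphere[of x] norm_to_unit_sphere[of y]
      by (simp add: power2_norm_eq_inner inner_diff_left inner_diff_right inner_commute
            norm_eq_1)
    then show "x = y" using inj_to_unit_sphere by (simp add: inj_eq)
  next
    assume "x = y"
    then show "dist x y = 0"
      using norm_to_unit_sphere[of y] by (simp add: dist_riemann_sphere_def norm_eq_1)
  qed
  show "dist x y \<le> dist x z + dist y z"
    using arccos_inner_triangle[of "to_unit_sphere x" "to_unit_sphere z" "to_unit_sphere y"]
    by (simp add: dist_riemann_sphere_def norm_to_unit_sphere inner_commute)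
qed (simp_all add: uniformity_riemann_sphere_def open_riemann_sphere_def)

end

section \<open>Meromorphic functions, normal families and shared zeros\<close>

definition sphere_domain :: "riemann_sphere set \<Rightarrow> bool" where
  "sphere_domain D \<longleftrightarrow> open D \<and> connected D \<and> D \<noteq> {}"

primrec finite_part :: "riemann_sphere \<Rightarrow> complex" where
  "finite_part (Finite z) = z"
| "finite_part Infty = 0"

text \<open>Functions on a subset of the sphere are represented by total functions whose values outside the
  set are irrelevant. Near \<open>z\<close> the function is finite except possibly at \<open>z\<close> itself, where it is
  either holomorphic or has a pole, taking the value \<open>Infty\<close> exactly in the latter case. In particular
  a function that is constantly \<open>Infty\<close> is not meromorphic.\<close>

definition meromorphic_at_finite :: "(riemann_sphere \<Rightarrow> riemann_sphere) \<Rightarrow> complex \<Rightarrow> bool" where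
  "meromorphic_at_finite f z \<longleftrightarrow>
     (\<forall>\<^sub>F w in at z. f (Finite w) \<noteq> Infty) \<and>
     (if f (Finite z) = Infty
      then isolated_singularity_at (\<lambda>w. finite_part (f (Finite w))) z \<and>
           is_pole (\<lambda>w. finite_part (f (Finite w))) z
      else (\<lambda>w. finite_part (f (Finite w))) analytic_on {z})"

text \<open>The coordinate change \<open>z \<mapsto> 1 / z\<close>, used as chart around \<open>Infty\<close>.\<close>

primrec sphere_inverse :: "riemann_sphere \<Rightarrow> riemann_sphere" where
  "sphere_inverse (Finite z) = (if z = 0 then Infty else Finite (1 / z))"
| "sphere_inverse Infty = Finite 0"

primrec meromorphic_at :: "(riemann_sphere \<Rightarrow> riemann_sphere) \<Rightarrow> riemann_sphere \<Rightarrow> bool" where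
  "meromorphic_at f (Finite z) \<longleftrightarrow> meromorphic_at_finite f z"
| "meromorphic_at f Infty \<longleftrightarrow> meromorphic_at_finite (f \<circ> sphere_inverse) 0"

definition meromorphic_maps :: "riemann_sphere set \<Rightarrow> (riemann_sphere \<Rightarrow> riemann_sphere) set" where
  "meromorphic_maps D = {f. \<forall>z\<in>D. meromorphic_at f z}"

definition infinity_maps :: "riemann_sphere set \<Rightarrow> (riemann_sphere \<Rightarrow> riemann_sphere) set" where
  "infinity_maps D = {f. \<forall>z\<in>D. f z = Infty}"

definition locally_uniform_limit ::
    "riemann_sphere set \<Rightarrow> (nat \<Rightarrow> riemann_sphere \<Rightarrow> riemann_sphere) \<Rightarrow>
       (riemann_sphere \<Rightarrow> riemann_sphere) \<Rightarrow> bool" where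
  "locally_uniform_limit D h g \<longleftrightarrow>
     (\<forall>z\<in>D. \<exists>U. open U \<and> z \<in> U \<and> U \<subseteq> D \<and> uniform_limit U h g sequentially)"

definition normal_family ::
    "(riemann_sphere \<Rightarrow> riemann_sphere) set \<Rightarrow> riemann_sphere set \<Rightarrow> bool" where
  "normal_family F D \<longleftrightarrow>
     (\<forall>h. (\<forall>n. h n \<in> F) \<longrightarrow>
        (\<exists>r g. strict_mono (r :: nat \<Rightarrow> nat) \<and> g \<in> meromorphic_maps D \<union> infinity_maps D \<and>
               locally_uniform_limit D (h \<circ> r) g))"

text \<open>\<open>f - a\<close> and \<open>g - b\<close> share \<open>0\<close> in \<open>D\<close>: equality of values in the sphere, so common values \<open>Infty\<close>
  count as zeros; multiplicities are ignored.\<close>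

definition share_zero ::
    "riemann_sphere set \<Rightarrow> (riemann_sphere \<Rightarrow> riemann_sphere) \<Rightarrow> (riemann_sphere \<Rightarrow> riemann_sphere) \<Rightarrow>
       (riemann_sphere \<Rightarrow> riemann_sphere) \<Rightarrow> (riemann_sphere \<Rightarrow> riemann_sphere) \<Rightarrow> bool" where
  "share_zero D f a g b \<longleftrightarrow> {z \<in> D. f z = a z} = {z \<in> D. g z = b z}"

end

theory Submission
  imports Defs
begin

text \<open>Two facts carry the proof. The first concerns the exceptional functions alone: a holomorphic map
from a disc to the sphere that stays at distance at least \<open>\<epsilon>\<close> from another one can be lifted, on a
concentric disc whose relative size depends on \<open>\<epsilon>\<close> only, to a pair of holomorphic functions with
upper and lower bounds that depend on \<open>\<epsilon>\<close> only
(\<open>bounded_lift_of_separated\<close>). Indeed, two distinct points of the sphere are two complementary lines in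
\<open>\<complex>\<^sup>2\<close>; the entries of the projection onto the first line along the second depend holomorphically on the
points, and they are bounded by a multiple of the reciprocal of the distance. So the three
associated functions come with uniformly bounded homogeneous coordinates.

The second fact concerns \<open>f\<close>. Let \<open>L\<close> be the cross ratio of \<open>f\<close> with its three functions, so that \<open>L\<close>
takes the values \<open>0\<close>, \<open>\<infinity>\<close>, \<open>1\<close> exactly where \<open>f\<close> meets the first, second or third function. These sets are
closed, disjoint, and the same for all \<open>f\<close> in the family. Near a point \<open>c\<close> there are three
possibilities. If \<open>c\<close> lies in none of the sets, all the functions \<open>L\<close> omit \<open>0\<close>, \<open>1\<close>, \<open>\<infinity>\<close> on a common disc, and
Schottky's theorem bounds either \<open>L\<close> or \<open>1 / L\<close> (\<open>bounded_lift_omitting\<close>). If \<open>c\<close> is an isolated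
point of one of the sets, one may take this to be the set of zeros of \<open>L\<close>; then \<open>L\<close> is bounded near \<open>c\<close> by
Schottky's theorem on the punctured disc and two uses of the maximum principle
(\<open>schottky_isolated_zero\<close>). If \<open>c\<close> is not isolated, every \<open>f\<close> coincides with one of its associated functions
near \<open>c\<close>, and the first fact applies to \<open>f\<close> itself.

In each case \<open>f\<close>, written as a combination of the lifts of its associated functions with coefficients in which \<open>L\<close>
occurs linearly (\<open>bounded_lift_of_cross_ratio\<close>), has a lift near \<open>c\<close> with bounds common to the whole
family. Montel's theorem for the two components gives locally convergent subsequences; a diagonal
sequence over a countable cover of \<open>D\<close> converges locally uniformly, and by connectedness its limit is meromorphic or
identically \<open>\<infinity>\<close>.\<close>

section \<open>Homogeneous coordinates and the spherical distance\<close>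

text \<open>Points of the sphere are handled through homogeneous coordinates, in which \<open>\<infinity>\<close> is a point like any
other. The coordinates \<open>(0, 0)\<close> represent no point; \<open>point\<close> sends them to \<open>Infty\<close>.\<close>

definition point :: "complex \<times> complex \<Rightarrow> riemann_sphere" where
  "point v = (if snd v = 0 then Infty else Finite (fst v / snd v))"

primrec coords :: "riemann_sphere \<Rightarrow> complex \<times> complex" where
  "coords (Finite z) = (z, 1)"
| "coords Infty = (1, 0)"

definition wedge :: "complex \<times> complex \<Rightarrow> complex \<times> complex \<Rightarrow> complex" where
  "wedge v w = fst v * snd w - fst w * snd v"

definition smul :: "complex \<Rightarrow> complex \<times> complex \<Rightarrow> complex \<times> complex" where
  "smul c v = (c * fst v, c * snd v)"

lemma fst_smul [simp]: "fst (smul c v) = c * fst v"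
  and snd_smul [simp]: "snd (smul c v) = c * snd v"
  by (simp_all add: smul_def)

lemma wedge_smul_left [simp]: "wedge (smul c v) w = c * wedge v w"
  and wedge_smul_right [simp]: "wedge v (smul c w) = c * wedge v w"
  by (simp_all add: wedge_def algebra_simps)

lemma wedge_self [simp]: "wedge v v = 0"
  by (simp add: wedge_def)

lemma wedge_add_left: "wedge (u + v) w = wedge u w + wedge v w"
  by (simp add: wedge_def algebra_simps)

lemma wedge_swap: "wedge w v = - wedge v w"
  by (simp add: wedge_def)

lemma norm_smul: "norm (smul c v) = cmod c * norm v"
proof -
  have "norm (smul c v) = sqrt ((cmod c)\<^sup>2 * ((cmod (fst v))\<^sup>2 + (cmod (snd v))\<^sup>2))"
    by (simp add: smul_def norm_Pair norm_mult power_mult_distrib distrib_left)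
  then show ?thesis by (simp add: real_sqrt_mult norm_prod_def)
qed

lemma coords_nonzero: "coords x \<noteq> 0"
  by (cases x) (auto simp: zero_prod_def)

lemma point_coords [simp]: "point (coords x) = x"
  by (cases x) (auto simp: point_def)

lemma point_smul: "c \<noteq> 0 \<Longrightarrow> point (smul c v) = point v"
  by (simp add: point_def)

lemma coords_point:
  assumes "v \<noteq> 0"
  obtains c where "c \<noteq> 0" "v = smul c (coords (point v))"
proof (cases "snd v = 0")
  case True
  then show ?thesis using assms
    by (intro that[of "fst v"]) (auto simp: point_def smul_def prod_eq_iff)
next
  case False
  then show ?thesis
    by (intro that[of "snd v"]) (auto simp: point_def smul_def prod_eq_iff)
qed

lemma point_eq_iff:
  assumes "v \<noteq> 0" "w \<noteq> 0"
  shows "point v = point w \<longleftrightarrow> wedge v w = 0"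
  using assms by (auto simp: point_def wedge_def prod_eq_iff field_simps)

lemma coords_eq_iff: "x = y \<longleftrightarrow> wedge (coords x) (coords y) = 0"
  using point_eq_iff[OF coords_nonzero coords_nonzero, of x y] by simp

lemma to_unit_sphere_point:
  assumes "v \<noteq> 0"
  shows "to_unit_sphere (point v) =
    ((2 / (norm v)\<^sup>2) *\<^sub>R (fst v * cnj (snd v)), ((cmod (fst v))\<^sup>2 - (cmod (snd v))\<^sup>2) / (norm v)\<^sup>2)"
proof (cases v)
  case (Pair p q)
  show ?thesis
  proof (cases "q = 0")
    case True
    then show ?thesis using assms by (simp add: Pair point_def norm_Pair zero_prod_def)
  next
    case False
    have N: "(norm v)\<^sup>2 = (cmod p)\<^sup>2 + (cmod q)\<^sup>2" by (simp add: Pair norm_Pair)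
    have q: "(cmod q)\<^sup>2 \<noteq> 0" using False by simp
    have n0: "(norm v)\<^sup>2 \<noteq> 0" using assms by simp
    have e: "(cmod (p / q))\<^sup>2 + 1 = (norm v)\<^sup>2 / (cmod q)\<^sup>2"
      using q unfolding N by (simp add: norm_divide power_divide field_simps)
    have e2: "(cmod (p / q))\<^sup>2 - 1 = ((cmod p)\<^sup>2 - (cmod q)\<^sup>2) / (cmod q)\<^sup>2"
      using q by (simp add: norm_divide power_divide field_simps)
    have c: "complex_of_real ((cmod q)\<^sup>2) = q * cnj q" by (rule complex_norm_square)
    have "(2 / ((norm v)\<^sup>2 / (cmod q)\<^sup>2)) *\<^sub>R (p / q) = (2 / (norm v)\<^sup>2) *\<^sub>R (p * cnj q)"
      using False n0 by (simp add: scaleR_conv_of_real c field_simps flip: of_real_power)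
    then show ?thesis using False q n0
      by (simp add: Pair point_def e e2 del: of_real_power)
  qed
qed

text \<open>Lagrange's identity for vectors in \<open>\<complex>\<^sup>2\<close>, written with the Hopf coordinates
\<open>(2 p cnj q, |p|\<^sup>2 - |q|\<^sup>2)\<close> that occur in \<open>to_unit_sphere_point\<close>.\<close>

lemma norm_wedge_identity:
  "(norm v)\<^sup>2 * (norm w)\<^sup>2 - (4 * ((fst v * cnj (snd v)) \<bullet> (fst w * cnj (snd w)))
     + ((cmod (fst v))\<^sup>2 - (cmod (snd v))\<^sup>2) * ((cmod (fst w))\<^sup>2 - (cmod (snd w))\<^sup>2))
   = 2 * (cmod (wedge v w))\<^sup>2"
  by (simp add: norm_prod_def wedge_def cmod_power2 inner_complex_def, algebra)

text \<open>The wedge product of normalised coordinates is half the chordal distance. In this form distances can be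
read off from holomorphic expressions in the coordinates.\<close>

lemma inner_to_unit_sphere_point:
  assumes "v \<noteq> 0" "w \<noteq> 0"
  shows "to_unit_sphere (point v) \<bullet> to_unit_sphere (point w) =
    1 - 2 * (cmod (wedge v w) / (norm v * norm w))\<^sup>2"
proof -
  have n: "(norm v)\<^sup>2 \<noteq> 0" "(norm w)\<^sup>2 \<noteq> 0" using assms by simp_all
  have "to_unit_sphere (point v) \<bullet> to_unit_sphere (point w) =
     (4 * ((fst v * cnj (snd v)) \<bullet> (fst w * cnj (snd w)))
     + ((cmod (fst v))\<^sup>2 - (cmod (snd v))\<^sup>2) * ((cmod (fst w))\<^sup>2 - (cmod (snd w))\<^sup>2))
     / ((norm v)\<^sup>2 * (norm w)\<^sup>2)"
    unfolding to_unit_sphere_point[OF assms(1)] to_unit_sphere_point[OF assms(2)]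
    by (simp add: add_divide_distrib)
  also have "\<dots> = ((norm v)\<^sup>2 * (norm w)\<^sup>2 - 2 * (cmod (wedge v w))\<^sup>2) / ((norm v)\<^sup>2 * (norm w)\<^sup>2)"
    using norm_wedge_identity[of v w] by (intro arg_cong2[where f="(/)"]) linarith+
  also have "\<dots> = 1 - 2 * (cmod (wedge v w) / (norm v * norm w))\<^sup>2"
    using n by (simp add: diff_divide_distrib power_divide power_mult_distrib)
  finally show ?thesis .
qed

lemma dist_le_pi: "dist x y \<le> pi" for x y :: riemann_sphere
  using Cauchy_Schwarz_ineq2[of "to_unit_sphere x" "to_unit_sphere y"]
  by (auto simp: dist_riemann_sphere_def norm_to_unit_sphere intro!: arccos_ubound)

lemma cos_dist: "cos (dist x y) = to_unit_sphere x \<bullet> to_unit_sphere y"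
  using Cauchy_Schwarz_ineq2[of "to_unit_sphere x" "to_unit_sphere y"]
  by (simp add: dist_riemann_sphere_def norm_to_unit_sphere)

lemma sin_half_dist:
  assumes "v \<noteq> 0" "w \<noteq> 0"
  shows "sin (dist (point v) (point w) / 2) = cmod (wedge v w) / (norm v * norm w)"
proof -
  have "1 - 2 * (sin (dist (point v) (point w) / 2))\<^sup>2 = 1 - 2 * (cmod (wedge v w) / (norm v * norm w))\<^sup>2"
    using cos_dist[of "point v" "point w"] inner_to_unit_sphere_point[OF assms]
      cos_double_sin[of "dist (point v) (point w) / 2"] by simp
  moreover have "0 \<le> sin (dist (point v) (point w) / 2)"
    using dist_le_pi[of "point v" "point w"] pi_ge_zero
    by (intro sin_ge_zero) (simp, linarith)
  ultimately show ?thesis by (simp add: power2_eq_iff_nonneg)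
qed

lemma norm_wedge_le: "cmod (wedge v w) \<le> norm v * norm w"
proof (cases "v = 0 \<or> w = 0")
  case False
  then have "cmod (wedge v w) / (norm v * norm w) \<le> 1"
    using sin_half_dist[of v w] sin_le_one by metis
  then show ?thesis using False by (simp add: divide_le_eq)
qed (auto simp: wedge_def)

text \<open>Jordan's inequality, from the concavity of the sine. It bounds the great-circle distance by a multiple
of the chord.\<close>

lemma two_over_pi_le_sin:
  assumes "0 \<le> t" "t \<le> pi / 2"
  shows "2 * t / pi \<le> sin t"
proof -
  have "concave_on {0..pi/2} sin"
    unfolding concave_on_def
  proof (rule f''_ge0_imp_convex)
    show "((\<lambda>x. - sin x) has_real_derivative - cos x) (at x)" for x :: real
      by (auto intro!: derivative_eq_intros)
    show "((\<lambda>x. - cos x) has_real_derivative sin x) (at x)" for x :: real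
      by (auto intro!: derivative_eq_intros)
    show "0 \<le> sin x" if "x \<in> {0..pi/2}" for x :: real
      using that by (intro sin_ge_zero) auto
  qed auto
  from concave_onD[OF this, of "2 * t / pi" 0 "pi / 2"] show ?thesis
    using assms by (simp add: field_simps)
qed

lemma dist_le_chord:
  assumes "v \<noteq> 0" "w \<noteq> 0"
  shows "dist (point v) (point w) \<le> pi * (cmod (wedge v w) / (norm v * norm w))"
proof -
  have "dist (point v) (point w) / pi \<le> cmod (wedge v w) / (norm v * norm w)"
    using two_over_pi_le_sin[OF _ divide_right_mono[OF dist_le_pi[of "point v" "point w"]]]
    unfolding sin_half_dist[OF assms] by simp
  then show ?thesis by (subst (asm) divide_le_eq) (simp add: mult.commute)
qed

lemma wedge_ge_of_dist_ge:
  assumes "dist x y \<ge> \<epsilon>" "\<epsilon> > 0" "point v = x" "point w = y" "v \<noteq> 0" "w \<noteq> 0"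
  shows "cmod (wedge v w) \<ge> \<epsilon> / pi * (norm v * norm w)"
proof -
  have "\<epsilon> / pi \<le> cmod (wedge v w) / (norm v * norm w)"
    using dist_le_chord[OF assms(5,6)] assms(1,3,4) by (simp add: field_simps)
  then show ?thesis using assms by (simp add: field_simps)
qed

lemma dist_to_unit_sphere_le: "dist (to_unit_sphere x) (to_unit_sphere y) \<le> dist x y"
proof -
  have s: "to_unit_sphere z \<bullet> to_unit_sphere z = 1" for z
    using norm_to_unit_sphere[of z] by (simp add: norm_eq_1)
  have "(dist (to_unit_sphere x) (to_unit_sphere y))\<^sup>2 = 2 - 2 * cos (dist x y)"
    by (simp add: dist_norm power2_norm_eq_inner inner_diff_left inner_diff_right s cos_dist inner_commute)
  also have "\<dots> = (2 * sin (dist x y / 2))\<^sup>2"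
    using cos_double_sin[of "dist x y / 2"] by (simp add: power_mult_distrib)
  also have "\<dots> \<le> (dist x y)\<^sup>2"
    using abs_sin_x_le_abs_x[of "dist x y / 2"]
    by (intro abs_le_square_iff[THEN iffD1]) (simp add: abs_mult)
  finally show ?thesis by simp
qed

section \<open>Holomorphic maps to the sphere and their lifts\<close>

text \<open>The class \<open>holomorphic_to_sphere\<close> contains the meromorphic functions and the constant \<open>\<infinity>\<close> alike: both
have local lifts to \<open>\<complex>\<^sup>2 - {0}\<close>. Working with it avoids case distinctions at poles and treats
the three exceptional functions uniformly. The predicate \<open>bounded_lift\<close> quantifies such a lift: if
the functions of a family have lifts with common bounds \<open>M\<close> and \<open>m > 0\<close>, then Montel's theorem applies
to the components, and the lower bound survives in the limit.\<close>

definition holomorphic_pair :: "complex set \<Rightarrow> (complex \<Rightarrow> complex \<times> complex) \<Rightarrow> bool" where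
  "holomorphic_pair S v \<longleftrightarrow> (\<lambda>z. fst (v z)) holomorphic_on S \<and> (\<lambda>z. snd (v z)) holomorphic_on S"

definition lift_on ::
    "complex set \<Rightarrow> (complex \<Rightarrow> riemann_sphere) \<Rightarrow> (complex \<Rightarrow> complex \<times> complex) \<Rightarrow> bool" where
  "lift_on S u v \<longleftrightarrow> holomorphic_pair S v \<and> (\<forall>z\<in>S. v z \<noteq> 0 \<and> u z = point (v z))"

definition holomorphic_to_sphere :: "complex set \<Rightarrow> (complex \<Rightarrow> riemann_sphere) \<Rightarrow> bool" where
  "holomorphic_to_sphere S u \<longleftrightarrow> (\<forall>z\<in>S. \<exists>r>0. \<exists>v. lift_on (ball z r) u v)"

definition bounded_lift :: "real \<Rightarrow> real \<Rightarrow> complex set \<Rightarrow> (complex \<Rightarrow> riemann_sphere) \<Rightarrow> bool" where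
  "bounded_lift M m S u \<longleftrightarrow> (\<exists>v. lift_on S u v \<and> (\<forall>z\<in>S. norm (v z) \<le> M \<and> m \<le> norm (v z)))"

lemma holomorphic_pair_subset: "holomorphic_pair S v \<Longrightarrow> T \<subseteq> S \<Longrightarrow> holomorphic_pair T v"
  unfolding holomorphic_pair_def by (blast intro: holomorphic_on_subset)

lemma lift_on_subset: "lift_on S u v \<Longrightarrow> T \<subseteq> S \<Longrightarrow> lift_on T u v"
  unfolding lift_on_def using holomorphic_pair_subset by blast

lemma bounded_lift_subset: "bounded_lift M m S u \<Longrightarrow> T \<subseteq> S \<Longrightarrow> bounded_lift M m T u"
  unfolding bounded_lift_def using lift_on_subset by (meson subsetD)

lemma holomorphic_to_sphere_subset:
  "holomorphic_to_sphere S u \<Longrightarrow> T \<subseteq> S \<Longrightarrow> holomorphic_to_sphere T u"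
  unfolding holomorphic_to_sphere_def by blast

lemma holomorphic_wedge:
  "holomorphic_pair S v \<Longrightarrow> holomorphic_pair S w \<Longrightarrow> (\<lambda>z. wedge (v z) (w z)) holomorphic_on S"
  unfolding holomorphic_pair_def wedge_def by (auto intro!: holomorphic_intros)

lemma holomorphic_pair_smul:
  "c holomorphic_on S \<Longrightarrow> holomorphic_pair S v \<Longrightarrow> holomorphic_pair S (\<lambda>z. smul (c z) (v z))"
  unfolding holomorphic_pair_def by (auto intro!: holomorphic_intros)

lemma holomorphic_pair_add:
  "holomorphic_pair S v \<Longrightarrow> holomorphic_pair S w \<Longrightarrow> holomorphic_pair S (\<lambda>z. v z + w z)"
  unfolding holomorphic_pair_def by (auto intro!: holomorphic_intros)

lemma holomorphic_pair_compose:
  "holomorphic_pair S v \<Longrightarrow> h holomorphic_on T \<Longrightarrow> h ` T \<subseteq> S \<Longrightarrow> holomorphic_pair T (\<lambda>z. v (h z))"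
  unfolding holomorphic_pair_def
  using holomorphic_on_compose_gen[of h T "\<lambda>z. fst (v z)" S] holomorphic_on_compose_gen[of h T "\<lambda>z. snd (v z)" S]
  by (auto simp: o_def)

lemma holomorphic_on_localI:
  assumes "open S" and "\<And>z. z \<in> S \<Longrightarrow> \<exists>r>0. \<exists>g. g holomorphic_on ball z r \<and> (\<forall>w\<in>ball z r \<inter> S. f w = g w)"
  shows "f holomorphic_on S"
proof -
  have "f analytic_on S"
    unfolding analytic_on_def
  proof
    fix z assume z: "z \<in> S"
    then obtain r g where r: "r > 0" "g holomorphic_on ball z r" "\<forall>w\<in>ball z r \<inter> S. f w = g w"
      using assms(2) by blast
    obtain e where e: "e > 0" "ball z e \<subseteq> S" using assms(1) z open_contains_ball by blast
    have "f holomorphic_on ball z (min r e)"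
    proof (rule holomorphic_transform)
      show "g holomorphic_on ball z (min r e)" using r(2) by (rule holomorphic_on_subset) auto
      show "g w = f w" if "w \<in> ball z (min r e)" for w
        using that r(3) e(2) by (auto simp: subset_iff)
    qed
    then show "\<exists>e>0. f holomorphic_on ball z e" using r(1) e(1) by (intro exI[of _ "min r e"]) auto
  qed
  then show ?thesis using analytic_imp_holomorphic by blast
qed

lemma lift_on_coords:
  assumes "lift_on S u v" "z \<in> S"
  obtains c where "c \<noteq> 0" "v z = smul c (coords (u z))"
  using assms coords_point[of "v z"] unfolding lift_on_def by metis

section \<open>Separated pairs\<close>

text \<open>For linearly independent \<open>v\<close> and \<open>w\<close> the two choices \<open>fst\<close> and \<open>snd\<close> of \<open>\<beta>\<close> give, up to sign, the
columns of the matrix of the projection onto the line of \<open>v\<close> along the line of \<open>w\<close>. It depends only on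
the two points represented by \<open>v\<close> and \<open>w\<close>, so for two maps to the sphere it is globally defined even
though their lifts are not.\<close>

definition proj_column ::
    "(complex \<times> complex \<Rightarrow> complex) \<Rightarrow> complex \<times> complex \<Rightarrow> complex \<times> complex \<Rightarrow> complex \<times> complex" where
  "proj_column \<beta> v w = smul (\<beta> w / wedge v w) v"

lemma proj_column_smul:
  assumes "\<beta> = fst \<or> \<beta> = snd" "c \<noteq> 0" "d \<noteq> 0"
  shows "proj_column \<beta> (smul c v) (smul d w) = proj_column \<beta> v w"
  using assms by (auto simp: proj_column_def prod_eq_iff)

text \<open>Each column has at most the operator norm of the projection, which is the reciprocal of the normalised wedge
product; so separation of the two points bounds it.\<close>

lemma norm_proj_column_le:
  assumes "\<beta> = fst \<or> \<beta> = snd" "v \<noteq> 0" "w \<noteq> 0" "dist (point v) (point w) \<ge> \<epsilon>" "\<epsilon> > 0"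
  shows "norm (proj_column \<beta> v w) \<le> pi / \<epsilon>"
proof -
  have "\<epsilon> / pi * (norm v * norm w) \<le> cmod (wedge v w)"
    using wedge_ge_of_dist_ge[OF assms(4,5) refl refl assms(2,3)] .
  moreover have p: "\<epsilon> / pi * (norm v * norm w) > 0" using assms by simp
  ultimately have w: "cmod (wedge v w) > 0" by linarith
  have \<beta>: "cmod (\<beta> w) \<le> norm w"
    using assms(1) norm_fst_le[of "fst w" "snd w"] norm_snd_le[of "snd w" "fst w"] by auto
  have "norm (proj_column \<beta> v w) = cmod (\<beta> w) * norm v / cmod (wedge v w)"
    by (simp add: proj_column_def norm_smul norm_divide)
  also have "\<dots> \<le> norm w * norm v / cmod (wedge v w)"
    using \<beta> w by (intro divide_right_mono mult_right_mono) auto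
  also have "\<dots> \<le> norm w * norm v / (\<epsilon> / pi * (norm v * norm w))"
    using \<open>\<epsilon> / pi * (norm v * norm w) \<le> cmod (wedge v w)\<close> p w
    by (intro divide_left_mono mult_pos_pos[OF w p]) auto
  also have "\<dots> = pi / \<epsilon>" using assms by (simp add: field_simps)
  finally show ?thesis .
qed

lemma holomorphic_proj_column:
  assumes "open S" "holomorphic_to_sphere S u" "holomorphic_to_sphere S v"
    and "\<And>z. z \<in> S \<Longrightarrow> u z \<noteq> v z" and \<beta>: "\<beta> = fst \<or> \<beta> = snd"
  shows "holomorphic_pair S (\<lambda>z. proj_column \<beta> (coords (u z)) (coords (v z)))"
proof -
  have *: "\<exists>r>0. \<exists>g. holomorphic_pair (ball z r) g \<and>
      (\<forall>w\<in>ball z r \<inter> S. proj_column \<beta> (coords (u w)) (coords (v w)) = g w)" if z: "z \<in> S" for z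
  proof -
    obtain r1 U where U: "r1 > 0" "lift_on (ball z r1) u U"
      using assms(2) z unfolding holomorphic_to_sphere_def by blast
    obtain r2 V where V: "r2 > 0" "lift_on (ball z r2) v V"
      using assms(3) z unfolding holomorphic_to_sphere_def by blast
    obtain r3 where r3: "r3 > 0" "ball z r3 \<subseteq> S" using assms(1) z open_contains_ball by blast
    define r where "r = min r1 (min r2 r3)"
    have U': "lift_on (ball z r) u U" and V': "lift_on (ball z r) v V"
      by (rule lift_on_subset[OF U(2)], force simp: r_def, rule lift_on_subset[OF V(2)], force simp: r_def)
    have hU: "holomorphic_pair (ball z r) U" and hV: "holomorphic_pair (ball z r) V"
      using U' V' by (auto simp: lift_on_def)
    have ne: "wedge (U w) (V w) \<noteq> 0" if w: "w \<in> ball z r" for w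
    proof -
      have "u w \<noteq> v w" using w r3 assms(4) by (auto simp: r_def)
      then show ?thesis using U' V' w point_eq_iff[of "U w" "V w"] by (auto simp: lift_on_def)
    qed
    have "(\<lambda>w. \<beta> (V w)) holomorphic_on ball z r"
      using hV \<beta> by (auto simp: holomorphic_pair_def)
    then have "holomorphic_pair (ball z r) (\<lambda>w. proj_column \<beta> (U w) (V w))"
      unfolding proj_column_def using ne hU hV
      by (intro holomorphic_pair_smul holomorphic_intros holomorphic_wedge) auto
    moreover have "proj_column \<beta> (coords (u w)) (coords (v w)) = proj_column \<beta> (U w) (V w)"
      if w: "w \<in> ball z r" for w
    proof -
      obtain c where "c \<noteq> 0" "U w = smul c (coords (u w))" using lift_on_coords[OF U' w] .
      moreover obtain d where "d \<noteq> 0" "V w = smul d (coords (v w))" using lift_on_coords[OF V' w] .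
      ultimately show ?thesis using proj_column_smul[OF \<beta>] by simp
    qed
    ultimately show ?thesis using U(1) V(1) r3(1) by (intro exI[of _ r]) (auto simp: r_def)
  qed
  show ?thesis
    unfolding holomorphic_pair_def
  proof (intro conjI; rule holomorphic_on_localI[OF assms(1)])
    fix z assume "z \<in> S"
    from *[OF this] obtain r g where r: "r > 0" "holomorphic_pair (ball z r) g"
      "\<forall>w\<in>ball z r \<inter> S. proj_column \<beta> (coords (u w)) (coords (v w)) = g w" by blast
    show "\<exists>r>0. \<exists>g. g holomorphic_on ball z r \<and>
       (\<forall>w\<in>ball z r \<inter> S. fst (proj_column \<beta> (coords (u w)) (coords (v w))) = g w)"
      using r unfolding holomorphic_pair_def by (intro exI[of _ r] conjI exI[of _ "\<lambda>w. fst (g w)"]) auto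
    show "\<exists>r>0. \<exists>g. g holomorphic_on ball z r \<and>
       (\<forall>w\<in>ball z r \<inter> S. snd (proj_column \<beta> (coords (u w)) (coords (v w))) = g w)"
      using r unfolding holomorphic_pair_def by (intro exI[of _ r] conjI exI[of _ "\<lambda>w. snd (g w)"]) auto
  qed
qed

text \<open>Schwarz's lemma, applied to \<open>h - h c\<close> scaled by \<open>3 * B\<close> rather than \<open>2 * B\<close> to have a strict bound.\<close>

lemma bounded_holomorphic_lipschitz:
  assumes h: "h holomorphic_on ball c R" and B: "B > 0" "\<And>z. z \<in> ball c R \<Longrightarrow> cmod (h z) \<le> B"
    and z: "z \<in> ball c R"
  shows "cmod (h z - h c) \<le> 3 * B / R * cmod (z - c)"
proof -
  have R: "R > 0" using z by (metis ball_eq_empty empty_iff not_le)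
  define g where "g = (\<lambda>\<zeta>. (h (c + of_real R * \<zeta>) - h c) / of_real (3 * B))"
  have mem: "c + of_real R * \<zeta> \<in> ball c R" if "\<zeta> \<in> ball 0 1" for \<zeta> :: complex
    using that R by (auto simp: dist_norm norm_mult)
  have "(h \<circ> (\<lambda>\<zeta>. c + of_real R * \<zeta>)) holomorphic_on ball 0 1"
    by (rule holomorphic_on_compose_gen[OF _ h]) (auto intro!: holomorphic_intros mem simp del: mem_ball)
  then have "(\<lambda>\<zeta>. h (c + of_real R * \<zeta>)) holomorphic_on ball 0 1" by (simp add: o_def)
  then have hol: "g holomorphic_on ball 0 1"
    unfolding g_def using B by (auto intro!: holomorphic_intros)
  have lt: "cmod (g \<zeta>) < 1" if "cmod \<zeta> < 1" for \<zeta>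
  proof -
    have "cmod (h (c + of_real R * \<zeta>) - h c) \<le> B + B"
      using that R by (intro order_trans[OF norm_triangle_ineq4] add_mono B(2) mem) auto
    then show ?thesis using B by (simp add: g_def norm_divide)
  qed
  have "cmod ((z - c) / of_real R) < 1" using z R by (simp add: norm_divide dist_norm norm_minus_commute)
  from Schwarz_Lemma(1)[OF hol _ lt this] have "cmod (g ((z - c) / of_real R)) \<le> cmod (z - c) / R"
    using R by (simp add: g_def norm_divide)
  then show ?thesis using R B by (simp add: g_def norm_divide norm_mult field_simps)
qed

text \<open>A map that stays away from another map has a lift near the centre whose bounds depend on the
separation only, as does the ratio of the radii of the two discs. Both columns of the projection are bounded holomorphic pairs, and each represents \<open>u\<close>
where it does not vanish. Since the trace is one, one of the diagonal entries has modulus at least \<open>1/2\<close> at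
the centre; being Lipschitz, it remains at least \<open>1/4\<close> on the smaller disc,
the radius of which is a quarter of the reciprocal Lipschitz constant.\<close>

lemma bounded_lift_of_separated:
  assumes "R > 0" "\<epsilon> > 0" and u: "holomorphic_to_sphere (ball c R) u" and v: "holomorphic_to_sphere (ball c R) v"
    and sep: "\<And>z. z \<in> ball c R \<Longrightarrow> dist (u z) (v z) \<ge> \<epsilon>"
  shows "bounded_lift (pi / \<epsilon>) (1/4) (ball c (min R (R * \<epsilon> / (12 * pi)))) u"
proof -
  define P where "P = (\<lambda>\<beta> z. proj_column \<beta> (coords (u z)) (coords (v z)))"
  have ne: "u z \<noteq> v z" if "z \<in> ball c R" for z using sep[OF that] assms(2) by auto
  have nP: "norm (P \<beta> z) \<le> pi / \<epsilon>" if "\<beta> = fst \<or> \<beta> = snd" "z \<in> ball c R" for \<beta> z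
    unfolding P_def using that sep assms(2) by (intro norm_proj_column_le coords_nonzero) auto
  have hP: "holomorphic_pair (ball c R) (P \<beta>)" if "\<beta> = fst \<or> \<beta> = snd" for \<beta>
    unfolding P_def using that ne u v by (intro holomorphic_proj_column) auto
  let ?\<rho> = "min R (R * \<epsilon> / (12 * pi))"
  have key: "bounded_lift (pi / \<epsilon>) (1/4) (ball c ?\<rho>) u"
    if \<beta>: "\<beta> = fst \<or> \<beta> = snd" and \<gamma>: "\<gamma> = fst \<or> \<gamma> = snd" and c: "cmod (\<gamma> (P \<beta> c)) \<ge> 1/2" for \<beta> \<gamma>
  proof -
    have le: "cmod (\<gamma> x) \<le> norm x" for x :: "complex \<times> complex"
      using \<gamma> norm_fst_le[of "fst x" "snd x"] norm_snd_le[of "snd x" "fst x"] by auto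
    have hg: "(\<lambda>z. \<gamma> (P \<beta> z)) holomorphic_on ball c R"
      using hP[OF \<beta>] \<gamma> by (auto simp: holomorphic_pair_def)
    have lower: "1/4 \<le> norm (P \<beta> z)" if z: "z \<in> ball c ?\<rho>" for z
    proof -
      have "cmod (\<gamma> (P \<beta> z) - \<gamma> (P \<beta> c)) \<le> 3 * (pi / \<epsilon>) / R * cmod (z - c)"
        using z assms(2) nP[OF \<beta>] by (intro bounded_holomorphic_lipschitz[OF hg]) (auto intro: order_trans[OF le])
      also have "\<dots> \<le> 3 * (pi / \<epsilon>) / R * (R * \<epsilon> / (12 * pi))"
        using z assms(1,2) by (intro mult_left_mono) (auto simp: dist_norm norm_minus_commute)
      also have "\<dots> = 1/4" using assms(1,2) by simp
      finally have "cmod (\<gamma> (P \<beta> z)) \<ge> 1/4"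
        using c norm_triangle_ineq2[of "\<gamma> (P \<beta> c)" "\<gamma> (P \<beta> z)"] by (simp add: norm_minus_commute)
      then show ?thesis using le order_trans by blast
    qed
    have "lift_on (ball c ?\<rho>) u (P \<beta>)"
      unfolding lift_on_def
    proof (intro conjI ballI)
      show "holomorphic_pair (ball c ?\<rho>) (P \<beta>)" by (rule holomorphic_pair_subset[OF hP[OF \<beta>]]) auto
      fix z assume z: "z \<in> ball c ?\<rho>"
      show nz: "P \<beta> z \<noteq> 0" using lower[OF z] by auto
      have "\<beta> (coords (v z)) / wedge (coords (u z)) (coords (v z)) \<noteq> 0"
        using nz by (auto simp: P_def proj_column_def prod_eq_iff)
      then show "u z = point (P \<beta> z)" unfolding P_def proj_column_def by (simp add: point_smul)
    qed
    then show ?thesis using lower nP[OF \<beta>] unfolding bounded_lift_def by (intro exI[of _ "P \<beta>"]) auto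
  qed
  \<comment> \<open>the projection has trace one\<close>
  have "wedge (coords (u c)) (coords (v c)) \<noteq> 0"
    using ne[of c] assms(1) coords_eq_iff by auto
  moreover have "fst (P snd c) - snd (P fst c) =
      wedge (coords (u c)) (coords (v c)) / wedge (coords (u c)) (coords (v c))"
    unfolding P_def proj_column_def fst_smul snd_smul times_divide_eq_left diff_divide_distrib[symmetric]
    by (rule arg_cong2[where f = "(/)"]) (simp_all add: wedge_def mult.commute)
  ultimately have "fst (P snd c) - snd (P fst c) = 1" by simp
  then have "cmod (fst (P snd c)) + cmod (snd (P fst c)) \<ge> 1"
    using norm_triangle_ineq4[of "fst (P snd c)" "snd (P fst c)"] by simp
  then consider "cmod (fst (P snd c)) \<ge> 1/2" | "cmod (snd (P fst c)) \<ge> 1/2" by linarith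
  then show ?thesis using key by cases auto
qed

section \<open>The cross ratio\<close>

text \<open>The Moebius transformation that sends \<open>y1\<close>, \<open>y2\<close>, \<open>y3\<close> to \<open>0\<close>, \<open>\<infinity>\<close>, \<open>1\<close>, evaluated at \<open>x\<close>. It turns
functions with three moving exceptional values into functions with fixed ones. Division by zero gives it the value
\<open>0\<close> instead of \<open>\<infinity>\<close> at \<open>x = y2\<close>, so it is used away from that point.\<close>

definition cross_ratio :: "riemann_sphere \<Rightarrow> riemann_sphere \<Rightarrow> riemann_sphere \<Rightarrow> riemann_sphere \<Rightarrow> complex" where
  "cross_ratio x y1 y2 y3 =
     (wedge (coords y1) (coords x) * wedge (coords y3) (coords y2)) /
     (wedge (coords y1) (coords y3) * wedge (coords x) (coords y2))"

lemma cross_ratio_point: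
  assumes "x \<noteq> 0" "y1 \<noteq> 0" "y2 \<noteq> 0" "y3 \<noteq> 0"
  shows "cross_ratio (point x) (point y1) (point y2) (point y3) =
     (wedge y1 x * wedge y3 y2) / (wedge y1 y3 * wedge x y2)"
proof -
  obtain c c1 c2 c3 where c: "c \<noteq> 0" "c1 \<noteq> 0" "c2 \<noteq> 0" "c3 \<noteq> 0"
    and e: "x = smul c (coords (point x))" "y1 = smul c1 (coords (point y1))"
      "y2 = smul c2 (coords (point y2))" "y3 = smul c3 (coords (point y3))"
    using coords_point[OF assms(1)] coords_point[OF assms(2)] coords_point[OF assms(3)] coords_point[OF assms(4)]
    by metis
  define X Y1 Y2 Y3 where XY: "X = coords (point x)" "Y1 = coords (point y1)"
    "Y2 = coords (point y2)" "Y3 = coords (point y3)"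
  show ?thesis
    unfolding cross_ratio_def XY[symmetric] using c e[folded XY] by simp
qed

lemma cross_ratio_eq_0_iff:
  assumes "y3 \<noteq> y2" "y1 \<noteq> y3" "x \<noteq> y2"
  shows "cross_ratio x y1 y2 y3 = 0 \<longleftrightarrow> x = y1"
  using assms coords_eq_iff[of y3 y2] coords_eq_iff[of y1 y3] coords_eq_iff[of x y2] coords_eq_iff[of y1 x]
  by (auto simp: cross_ratio_def)

lemma wedge_pluecker: "wedge a b * wedge c d = wedge a c * wedge b d - wedge a d * wedge b c"
  by (simp add: wedge_def algebra_simps)

lemma cross_ratio_eq_1_iff:
  assumes "y1 \<noteq> y2" "y1 \<noteq> y3" "x \<noteq> y2"
  shows "cross_ratio x y1 y2 y3 = 1 \<longleftrightarrow> x = y3"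
  using assms coords_eq_iff[of y1 y2] coords_eq_iff[of y1 y3] coords_eq_iff[of x y2] coords_eq_iff[of x y3]
    wedge_pluecker[of "coords y1" "coords x" "coords y3" "coords y2"]
  by (auto simp: cross_ratio_def field_simps)

lemma cross_ratio_swap: "cross_ratio x y2 y1 y3 = 1 / cross_ratio x y1 y2 y3"
  unfolding cross_ratio_def
  using wedge_swap[of "coords y2" "coords x"] wedge_swap[of "coords y1" "coords x"]
    wedge_swap[of "coords y3" "coords y1"] wedge_swap[of "coords y3" "coords y2"]
  by (simp add: mult.commute)

lemma holomorphic_cross_ratio:
  assumes S: "open S" and hol: "holomorphic_to_sphere S f" "holomorphic_to_sphere S a1"
      "holomorphic_to_sphere S a2" "holomorphic_to_sphere S a3"
    and ne: "\<And>z. z \<in> S \<Longrightarrow> a1 z \<noteq> a3 z" "\<And>z. z \<in> S \<Longrightarrow> f z \<noteq> a2 z"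
  shows "(\<lambda>z. cross_ratio (f z) (a1 z) (a2 z) (a3 z)) holomorphic_on S"
proof (rule holomorphic_on_localI[OF S])
  fix z assume z: "z \<in> S"
  have "\<exists>r>0. \<exists>v. lift_on (ball z r) u v" if "holomorphic_to_sphere S u" for u
    using that z unfolding holomorphic_to_sphere_def by blast
  then obtain r0 r1 r2 r3 v0 v1 v2 v3 where rs: "r0 > 0" "r1 > 0" "r2 > 0" "r3 > 0"
    and vs: "lift_on (ball z r0) f v0" "lift_on (ball z r1) a1 v1"
      "lift_on (ball z r2) a2 v2" "lift_on (ball z r3) a3 v3"
    using hol by meson
  obtain r4 where r4: "r4 > 0" "ball z r4 \<subseteq> S" using S z open_contains_ball by blast
  define r where "r = min r0 (min r1 (min r2 (min r3 r4)))"
  have r: "r > 0" "r \<le> r0" "r \<le> r1" "r \<le> r2" "r \<le> r3" "r \<le> r4" using rs r4 by (auto simp: r_def)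
  have vs': "lift_on (ball z r) f v0" "lift_on (ball z r) a1 v1"
      "lift_on (ball z r) a2 v2" "lift_on (ball z r) a3 v3"
    using vs[THEN lift_on_subset] r by (meson subset_ball)+
  have nz: "wedge (v1 w) (v3 w) \<noteq> 0" "wedge (v0 w) (v2 w) \<noteq> 0" if w: "w \<in> ball z r" for w
  proof -
    have "w \<in> S" using w r4 r by (meson subsetD subset_ball)
    then show "wedge (v1 w) (v3 w) \<noteq> 0" "wedge (v0 w) (v2 w) \<noteq> 0"
      using ne[of w] vs' w point_eq_iff[of "v1 w" "v3 w"] point_eq_iff[of "v0 w" "v2 w"]
      by (auto simp: lift_on_def)
  qed
  have "(\<lambda>w. (wedge (v1 w) (v0 w) * wedge (v3 w) (v2 w)) / (wedge (v1 w) (v3 w) * wedge (v0 w) (v2 w)))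
      holomorphic_on ball z r"
    using vs' nz unfolding lift_on_def by (intro holomorphic_intros holomorphic_wedge) auto
  moreover have "cross_ratio (f w) (a1 w) (a2 w) (a3 w) =
      (wedge (v1 w) (v0 w) * wedge (v3 w) (v2 w)) / (wedge (v1 w) (v3 w) * wedge (v0 w) (v2 w))"
    if "w \<in> ball z r" for w
    using that vs' cross_ratio_point[of "v0 w" "v1 w" "v2 w" "v3 w"] by (auto simp: lift_on_def)
  ultimately show "\<exists>r>0. \<exists>g. g holomorphic_on ball z r \<and>
       (\<forall>w\<in>ball z r \<inter> S. cross_ratio (f w) (a1 w) (a2 w) (a3 w) = g w)"
    using r by blast
qed

text \<open>Back from the cross ratio to the function. If \<open>v1\<close>, \<open>v2\<close>, \<open>v3\<close> are lifts of the three functions and \<open>L\<close> is the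
cross ratio, then \<open>(v3 \<and> v2) v1 + L (v1 \<and> v3) v2\<close> is a lift of \<open>f\<close>, where \<open>\<and>\<close> stands for the wedge product.
It is bounded if \<open>L\<close> is. Its wedge product with \<open>v2\<close> does not involve \<open>L\<close> and is bounded below by the
separation, hence so is the lift.\<close>

lemma bounded_lift_of_cross_ratio:
  assumes S: "open S" and "m > 0" "\<epsilon> > 0"
    and f: "holomorphic_to_sphere S f"
    and hol: "holomorphic_to_sphere S a1" "holomorphic_to_sphere S a2" "holomorphic_to_sphere S a3"
    and lifts: "bounded_lift M m S a1" "bounded_lift M m S a2" "bounded_lift M m S a3"
    and sep: "\<And>z. z \<in> S \<Longrightarrow> dist (a1 z) (a2 z) \<ge> \<epsilon>" "\<And>z. z \<in> S \<Longrightarrow> dist (a1 z) (a3 z) \<ge> \<epsilon>"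
      "\<And>z. z \<in> S \<Longrightarrow> dist (a3 z) (a2 z) \<ge> \<epsilon>"
    and ne: "\<And>z. z \<in> S \<Longrightarrow> f z \<noteq> a2 z"
    and K: "\<And>z. z \<in> S \<Longrightarrow> cmod (cross_ratio (f z) (a1 z) (a2 z) (a3 z)) \<le> K"
  shows "bounded_lift ((1 + K) * M ^ 3) ((\<epsilon> / pi)\<^sup>2 * m ^ 4 / M) S f"
proof -
  define L where "L = (\<lambda>z. cross_ratio (f z) (a1 z) (a2 z) (a3 z))"
  obtain v1 where v1: "lift_on S a1 v1"
    and b1: "\<And>z. z \<in> S \<Longrightarrow> norm (v1 z) \<le> M" "\<And>z. z \<in> S \<Longrightarrow> m \<le> norm (v1 z)"
    using lifts(1) unfolding bounded_lift_def by blast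
  obtain v2 where v2: "lift_on S a2 v2"
    and b2: "\<And>z. z \<in> S \<Longrightarrow> norm (v2 z) \<le> M" "\<And>z. z \<in> S \<Longrightarrow> m \<le> norm (v2 z)"
    using lifts(2) unfolding bounded_lift_def by blast
  obtain v3 where v3: "lift_on S a3 v3"
    and b3: "\<And>z. z \<in> S \<Longrightarrow> norm (v3 z) \<le> M" "\<And>z. z \<in> S \<Longrightarrow> m \<le> norm (v3 z)"
    using lifts(3) unfolding bounded_lift_def by blast
  note v = v1 v2 v3
  define w where "w = (\<lambda>z. smul (wedge (v3 z) (v2 z)) (v1 z) + smul (L z * wedge (v1 z) (v3 z)) (v2 z))"
  have ne': "a1 z \<noteq> a3 z" if "z \<in> S" for z using sep(2)[OF that] assms(3) by auto
  have "L holomorphic_on S"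
    unfolding L_def using hol f ne ne' by (intro holomorphic_cross_ratio[OF S]) auto
  then have hw: "holomorphic_pair S w"
    unfolding w_def using v
    by (intro holomorphic_pair_add holomorphic_pair_smul holomorphic_intros holomorphic_wedge)
      (auto simp: lift_on_def)
  have *: "w z \<noteq> 0 \<and> f z = point (w z) \<and> norm (w z) \<le> (1 + K) * M ^ 3 \<and> (\<epsilon> / pi)\<^sup>2 * m ^ 4 / M \<le> norm (w z)"
    if z: "z \<in> S" for z
  proof -
    have M: "M > 0" using b1[OF z] assms(2) by linarith
    have nz: "v1 z \<noteq> 0" "v2 z \<noteq> 0" "v3 z \<noteq> 0"
      and pt: "a1 z = point (v1 z)" "a2 z = point (v2 z)" "a3 z = point (v3 z)"
      using v z by (auto simp: lift_on_def)
    have wl: "\<epsilon> / pi * m\<^sup>2 \<le> cmod (wedge x y)"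
      if "dist (point x) (point y) \<ge> \<epsilon>" "x \<noteq> 0" "y \<noteq> 0" "m \<le> norm x" "m \<le> norm y" for x y
    proof -
      have "\<epsilon> / pi * m\<^sup>2 \<le> \<epsilon> / pi * (norm x * norm y)"
        unfolding power2_eq_square using that assms(2,3) by (intro mult_left_mono mult_mono) auto
      then show ?thesis using wedge_ge_of_dist_ge[OF that(1) assms(3) refl refl that(2,3)] by linarith
    qed
    have wu: "cmod (wedge x y) \<le> M * M" if "norm x \<le> M" "norm y \<le> M" for x y
      using norm_wedge_le[of x y] mult_mono[OF that] M by simp
    have w32: "wedge (w z) (v2 z) = wedge (v3 z) (v2 z) * wedge (v1 z) (v2 z)"
      by (simp add: w_def wedge_add_left)
    have "(\<epsilon> / pi * m\<^sup>2) * (\<epsilon> / pi * m\<^sup>2) \<le> cmod (wedge (v3 z) (v2 z)) * cmod (wedge (v1 z) (v2 z))"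
      using sep[OF z] nz pt b1[OF z] b2[OF z] b3[OF z] assms(2,3) by (intro mult_mono wl) auto
    also have "\<dots> \<le> norm (w z) * M"
      using norm_wedge_le[of "w z" "v2 z"] mult_left_mono[OF b2(1)[OF z], of "norm (w z)"]
      by (simp add: w32 norm_mult)
    finally have low: "(\<epsilon> / pi)\<^sup>2 * m ^ 4 / M \<le> norm (w z)"
      using M by (simp add: divide_le_eq power2_eq_square power4_eq_xxxx mult_ac)
    moreover have "(\<epsilon> / pi)\<^sup>2 * m ^ 4 / M > 0" using M assms(2,3) by simp
    ultimately have wnz: "w z \<noteq> 0" by auto
    have tri: "norm (w z) \<le> cmod (wedge (v3 z) (v2 z)) * norm (v1 z) + (cmod (L z) * cmod (wedge (v1 z) (v3 z))) * norm (v2 z)"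
      unfolding w_def using norm_triangle_ineq by (metis norm_mult norm_smul)
    have "K \<ge> 0" using K[OF z] norm_ge_zero order_trans by blast
    with tri have "norm (w z) \<le> (M * M) * M + (K * (M * M)) * M"
      using K[OF z] b1[OF z] b2[OF z] b3[OF z] M unfolding L_def
      by (elim order_trans, intro add_mono mult_mono wu mult_nonneg_nonneg) auto
    also have "\<dots> = (1 + K) * M ^ 3" by (simp add: power3_eq_cube algebra_simps)
    finally have up: "norm (w z) \<le> (1 + K) * M ^ 3" .
    have f0: "coords (f z) \<noteq> 0" by (rule coords_nonzero)
    have d: "wedge (v1 z) (v3 z) \<noteq> 0" "wedge (coords (f z)) (v2 z) \<noteq> 0"
      using ne'[OF z] ne[OF z] pt nz point_eq_iff[of "v1 z" "v3 z"] point_eq_iff[OF f0, of "v2 z"] by auto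
    have "L z = (wedge (v1 z) (coords (f z)) * wedge (v3 z) (v2 z)) / (wedge (v1 z) (v3 z) * wedge (coords (f z)) (v2 z))"
      unfolding L_def using cross_ratio_point[OF f0 nz] pt by simp
    then have "L z * wedge (v1 z) (v3 z) * wedge (coords (f z)) (v2 z) = wedge (v1 z) (coords (f z)) * wedge (v3 z) (v2 z)"
      using d by (simp add: field_simps)
    then have "wedge (w z) (coords (f z)) = 0"
      using wedge_swap[of "v2 z" "coords (f z)"] by (simp add: w_def wedge_add_left mult.commute)
    then have "f z = point (w z)" using point_eq_iff[OF wnz f0] by simp
    then show ?thesis using wnz low up by simp
  qed
  then show ?thesis using hw unfolding bounded_lift_def lift_on_def by (intro exI[of _ w]) auto
qed

section \<open>Bounds for the cross ratio\<close>

text \<open>The bound of Schottky's theorem for the value \<open>2\<close> at the centre and the concentric disc of half the radius.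
All applications are reduced to this normalisation.\<close>

definition schottky_bound :: real where
  "schottky_bound = exp (pi * exp (pi * 18))"

lemma schottky_half:
  assumes "f holomorphic_on cball 0 1" "cmod (f 0) \<le> 2"
    and "\<And>z. z \<in> cball 0 1 \<Longrightarrow> f z \<noteq> 0 \<and> f z \<noteq> 1" and "cmod z \<le> 1/2"
  shows "cmod (f z) \<le> schottky_bound"
  using Schottky[of f 2 "1/2" z] assms unfolding schottky_bound_def by simp

lemma holomorphic_on_affine:
  assumes "f holomorphic_on ball c R" "0 < s" "s < R"
  shows "(\<lambda>\<zeta>. f (c + of_real s * \<zeta>)) holomorphic_on cball 0 1"
    and "\<And>\<zeta>. \<zeta> \<in> cball 0 1 \<Longrightarrow> c + of_real s * \<zeta> \<in> ball c R"
proof -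
  show *: "c + of_real s * \<zeta> \<in> ball c R" if "\<zeta> \<in> cball 0 1" for \<zeta>
  proof -
    have "s * cmod \<zeta> \<le> s" using that assms(2) by (simp add: mult_left_le)
    then have "s * cmod \<zeta> < R" using assms(3) by linarith
    then show ?thesis using assms(2) by (simp add: dist_norm norm_mult)
  qed
  have "(f \<circ> (\<lambda>\<zeta>. c + of_real s * \<zeta>)) holomorphic_on cball 0 1"
    by (rule holomorphic_on_compose_gen[OF _ assms(1)]) (auto intro!: holomorphic_intros * simp del: mem_ball)
  then show "(\<lambda>\<zeta>. f (c + of_real s * \<zeta>)) holomorphic_on cball 0 1" by (simp add: o_def)
qed

lemma schottky_ball:
  assumes f: "f holomorphic_on ball c R" and "R > 0" "cmod (f c) \<le> 2"
    and ne: "\<And>z. z \<in> ball c R \<Longrightarrow> f z \<noteq> 0 \<and> f z \<noteq> 1" and z: "z \<in> ball c (R/4)"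
  shows "cmod (f z) \<le> schottky_bound"
proof -
  note aff = holomorphic_on_affine[OF f, of "R/2"]
  let ?g = "\<lambda>\<zeta>. f (c + of_real (R/2) * \<zeta>)"
  have "cmod (?g ((z - c) / of_real (R/2))) \<le> schottky_bound"
  proof (rule schottky_half[of ?g])
    show "?g holomorphic_on cball 0 1" using aff(1) assms(2) by simp
    show "?g \<zeta> \<noteq> 0 \<and> ?g \<zeta> \<noteq> 1" if "\<zeta> \<in> cball 0 1" for \<zeta>
      using aff(2)[OF _ _ that] assms(2) by (intro ne) auto
    show "cmod ((z - c) / of_real (R/2)) \<le> 1/2"
      unfolding norm_divide norm_of_real
      using z assms(2) by (simp add: dist_norm norm_minus_commute divide_le_eq)
  qed (use assms in auto)
  moreover have "c + of_real (R/2) * ((z - c) / of_real (R/2)) = z" using assms(2) by (simp add: field_simps)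
  ultimately show ?thesis by (simp only:)
qed

text \<open>Schottky's theorem does not apply on the disc itself, as \<open>0\<close> is attained at the centre, but it does apply on
the punctured disc. What is missing there is a starting point at which \<open>L\<close> is known to be bounded; the maximum
principle for \<open>1 / (1 - L)\<close> provides one on a small circle. Pulled back by the exponential function,
Schottky's theorem then bounds \<open>L\<close> on the whole circle, and the maximum principle for \<open>L\<close> fills the disc.\<close>

lemma schottky_isolated_zero:
  assumes L: "L holomorphic_on ball c R" and R: "R > 0" and c: "L c = 0"
    and ne1: "\<And>z. z \<in> ball c R \<Longrightarrow> L z \<noteq> 1" and ne0: "\<And>z. z \<in> ball c R \<Longrightarrow> z \<noteq> c \<Longrightarrow> L z \<noteq> 0"
    and z: "z \<in> ball c (R * exp (-9))"
  shows "cmod (L z) \<le> schottky_bound"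
proof -
  define s where "s = R * exp (-9)"
  have s: "0 < s" "s < R" using R by (auto simp: s_def)
  have sub: "cball c s \<subseteq> ball c R" using s by auto
  have cont: "continuous_on (sphere c s) (\<lambda>z. cmod (1 - L z))"
    using holomorphic_on_imp_continuous_on[OF holomorphic_on_subset[OF L, of "sphere c s"]] sub
    by (force intro!: continuous_intros)
  obtain z1 where z1: "z1 \<in> sphere c s" "\<And>z. z \<in> sphere c s \<Longrightarrow> cmod (1 - L z1) \<le> cmod (1 - L z)"
    using continuous_attains_inf[OF _ _ cont] s by auto
  have z1': "z1 \<in> ball c R" using z1(1) s by auto
  have pos: "cmod (1 - L z1) > 0" using ne1[OF z1'] by simp
  \<comment> \<open>since \<open>1 / (1 - L)\<close> equals \<open>1\<close> at the centre, its modulus is at least \<open>1\<close> somewhere on the circle\<close>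
  have "(\<lambda>z. 1 / (1 - L z)) holomorphic_on ball c R"
    using L ne1 by (intro holomorphic_intros) auto
  then have hG: "(\<lambda>z. 1 / (1 - L z)) holomorphic_on cball c s" using sub by (rule holomorphic_on_subset)
  have "cmod (1 / (1 - L c)) \<le> 1 / cmod (1 - L z1)"
  proof (rule maximum_modulus_frontier[where S = "cball c s" and f = "\<lambda>z. 1 / (1 - L z)"])
    show "(\<lambda>z. 1 / (1 - L z)) holomorphic_on interior (cball c s)"
      using hG by (rule holomorphic_on_subset) (rule interior_subset)
    show "continuous_on (closure (cball c s)) (\<lambda>z. 1 / (1 - L z))"
      using hG holomorphic_on_imp_continuous_on by simp
    show "cmod (1 / (1 - L z)) \<le> 1 / cmod (1 - L z1)" if "z \<in> frontier (cball c s)" for z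
    proof -
      have "z \<in> sphere c s" using that by simp
      then show ?thesis using z1(2)[of z] pos by (simp add: norm_divide divide_simps split: if_splits)
    qed
  qed (use s in auto)
  then have "cmod (1 - L z1) \<le> 1" using pos c by simp
  then have L1: "cmod (L z1) \<le> 2" using norm_triangle_ineq4[of 1 "1 - L z1"] by simp
  have z1c: "cmod (z1 - c) = s" "z1 \<noteq> c" using z1(1) s by (auto simp: dist_norm norm_minus_commute)
  \<comment> \<open>In the logarithmic coordinate centred at \<open>z1\<close> the disc of radius 8 stays inside the punctured disc, as
    \<open>s * exp 8 < R\<close>, and the disc of radius 4 covers the circle, as \<open>\<pi> < 4\<close>.\<close>
  define g where "g = (\<lambda>\<zeta>. L (c + (z1 - c) * exp (8 * \<zeta>)))"
  have mem: "c + (z1 - c) * exp (8 * \<zeta>) \<in> ball c R - {c}" if "\<zeta> \<in> cball 0 1" for \<zeta> :: complex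
  proof -
    have "Re (8 * \<zeta>) \<le> 8" using that complex_Re_le_cmod[of \<zeta>] by simp
    then have "cmod ((z1 - c) * exp (8 * \<zeta>)) \<le> s * exp 8"
      using s z1c by (simp add: norm_mult)
    also have "\<dots> = R * exp (-1)" by (simp add: s_def flip: exp_add)
    also have "\<dots> < R" using R by simp
    finally show ?thesis using z1c by (simp add: dist_norm)
  qed
  have g: "cmod (g \<zeta>) \<le> schottky_bound" if "cmod \<zeta> \<le> 1/2" for \<zeta>
  proof (rule schottky_half[OF _ _ _ that])
    have "(L \<circ> (\<lambda>\<zeta>. c + (z1 - c) * exp (8 * \<zeta>))) holomorphic_on cball 0 1"
      by (rule holomorphic_on_compose_gen[OF _ L]) (use mem in \<open>auto intro!: holomorphic_intros simp del: mem_ball\<close>)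
    then show "g holomorphic_on cball 0 1" by (simp add: g_def o_def)
    show "cmod (g 0) \<le> 2" using L1 by (simp add: g_def)
    show "g \<zeta> \<noteq> 0 \<and> g \<zeta> \<noteq> 1" if "\<zeta> \<in> cball 0 1" for \<zeta>
      using mem[OF that] ne0 ne1 by (simp add: g_def)
  qed
  have circ: "cmod (L w) \<le> schottky_bound" if w: "w \<in> sphere c s" for w
  proof -
    define q where "q = (w - c) / (z1 - c)"
    have q: "cmod q = 1" using w z1c s by (simp add: q_def norm_divide dist_norm norm_minus_commute)
    then have q0: "q \<noteq> 0" by auto
    have "Arg q \<le> pi" "- pi < Arg q" using Arg_bounded by auto
    then have "\<bar>Arg q\<bar> \<le> 4" using pi_less_4 by linarith
    then have "cmod (\<i> * of_real (Arg q) / 8) \<le> 1/2" by (simp add: norm_mult norm_divide)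
    from g[OF this] have "cmod (L (c + (z1 - c) * exp (\<i> * of_real (Arg q)))) \<le> schottky_bound"
      by (simp add: g_def)
    moreover have "exp (\<i> * of_real (Arg q)) = q" using Arg_eq[OF q0] q by simp
    ultimately show ?thesis using z1c by (simp add: q_def)
  qed
  have hL: "L holomorphic_on cball c s" using L sub by (rule holomorphic_on_subset)
  show ?thesis
  proof (rule maximum_modulus_frontier[where S = "cball c s" and f = L])
    show "L holomorphic_on interior (cball c s)"
      using hL by (rule holomorphic_on_subset) (rule interior_subset)
    show "continuous_on (closure (cball c s)) L"
      using hL holomorphic_on_imp_continuous_on by simp
  qed (use circ z s in \<open>auto simp: s_def\<close>)
qed

section \<open>Functions that avoid or meet a separated triple\<close>

definition separated_triple ::
    "real \<Rightarrow> complex set \<Rightarrow> (complex \<Rightarrow> riemann_sphere) \<Rightarrow> (complex \<Rightarrow> riemann_sphere) \<Rightarrow>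
       (complex \<Rightarrow> riemann_sphere) \<Rightarrow> bool" where
  "separated_triple \<epsilon> S a1 a2 a3 \<longleftrightarrow>
     holomorphic_to_sphere S a1 \<and> holomorphic_to_sphere S a2 \<and> holomorphic_to_sphere S a3 \<and>
     (\<forall>z\<in>S. dist (a1 z) (a2 z) \<ge> \<epsilon> \<and> dist (a1 z) (a3 z) \<ge> \<epsilon> \<and> dist (a2 z) (a3 z) \<ge> \<epsilon>)"

lemma separated_triple_permute:
  assumes "separated_triple \<epsilon> S a1 a2 a3"
  shows "separated_triple \<epsilon> S a2 a1 a3" "separated_triple \<epsilon> S a3 a1 a2"
  using assms unfolding separated_triple_def by (auto simp: dist_commute)

lemma separated_triple_subset:
  "separated_triple \<epsilon> S a1 a2 a3 \<Longrightarrow> T \<subseteq> S \<Longrightarrow> separated_triple \<epsilon> T a1 a2 a3"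
  unfolding separated_triple_def using holomorphic_to_sphere_subset by blast

lemma separated_triple_ne:
  assumes "separated_triple \<epsilon> S a1 a2 a3" "\<epsilon> > 0" "z \<in> S"
  shows "a1 z \<noteq> a2 z" "a1 z \<noteq> a3 z" "a2 z \<noteq> a3 z"
  using assms unfolding separated_triple_def by force+

text \<open>The constants are chosen before the functions and the centre. This order of quantifiers is what later yields
bounds that hold for the whole family at once.\<close>

lemma bounded_lift_uniform:
  assumes "R > 0" "\<epsilon> > 0" "s > 0"
  obtains \<rho> M m where "\<rho> > 0" "\<rho> \<le> s" "m > 0"
    "\<And>f a1 a2 a3 c. holomorphic_to_sphere (ball c R) f \<Longrightarrow> separated_triple \<epsilon> (ball c R) a1 a2 a3 \<Longrightarrow>
       (\<And>z. z \<in> ball c R \<Longrightarrow> f z \<noteq> a2 z) \<Longrightarrow>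
       (\<And>z. z \<in> ball c s \<Longrightarrow> cmod (cross_ratio (f z) (a1 z) (a2 z) (a3 z)) \<le> schottky_bound) \<Longrightarrow>
       bounded_lift M m (ball c \<rho>) f"
proof
  let ?\<rho> = "min s (min R (R * \<epsilon> / (12 * pi)))"
  let ?M = "pi / \<epsilon>" and ?m = "1 / 4 :: real"
  show "?\<rho> > 0" "?\<rho> \<le> s" "(\<epsilon> / pi)\<^sup>2 * ?m ^ 4 / ?M > 0" using assms by auto
  fix f a1 a2 a3 c
  assume f: "holomorphic_to_sphere (ball c R) f" and t: "separated_triple \<epsilon> (ball c R) a1 a2 a3"
    and ne: "\<And>z. z \<in> ball c R \<Longrightarrow> f z \<noteq> a2 z"
    and K: "\<And>z. z \<in> ball c s \<Longrightarrow> cmod (cross_ratio (f z) (a1 z) (a2 z) (a3 z)) \<le> schottky_bound"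
  have hol: "holomorphic_to_sphere (ball c R) a1" "holomorphic_to_sphere (ball c R) a2" "holomorphic_to_sphere (ball c R) a3"
    and sep: "\<And>z. z \<in> ball c R \<Longrightarrow> dist (a1 z) (a2 z) \<ge> \<epsilon>" "\<And>z. z \<in> ball c R \<Longrightarrow> dist (a1 z) (a3 z) \<ge> \<epsilon>"
      "\<And>z. z \<in> ball c R \<Longrightarrow> dist (a3 z) (a2 z) \<ge> \<epsilon>"
    using t unfolding separated_triple_def by (auto simp: dist_commute)
  have sub: "ball c ?\<rho> \<subseteq> ball c R" "ball c ?\<rho> \<subseteq> ball c s" by auto
  note bl = bounded_lift_of_separated[OF assms(1,2)]
  have lifts: "bounded_lift ?M ?m (ball c (min R (R * \<epsilon> / (12 * pi)))) a1"
    "bounded_lift ?M ?m (ball c (min R (R * \<epsilon> / (12 * pi)))) a2"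
    "bounded_lift ?M ?m (ball c (min R (R * \<epsilon> / (12 * pi)))) a3"
    using bl[OF hol(1,2) sep(1)] bl[OF hol(2,3)] bl[OF hol(3,2) sep(3)] sep by (auto simp: dist_commute)
  show "bounded_lift ((1 + schottky_bound) * ?M ^ 3) ((\<epsilon> / pi)\<^sup>2 * ?m ^ 4 / ?M) (ball c ?\<rho>) f"
  proof (rule bounded_lift_of_cross_ratio)
    show "bounded_lift ?M ?m (ball c ?\<rho>) a1" "bounded_lift ?M ?m (ball c ?\<rho>) a2" "bounded_lift ?M ?m (ball c ?\<rho>) a3"
      using lifts by (auto elim!: bounded_lift_subset)
    show "holomorphic_to_sphere (ball c ?\<rho>) f" "holomorphic_to_sphere (ball c ?\<rho>) a1"
      "holomorphic_to_sphere (ball c ?\<rho>) a2" "holomorphic_to_sphere (ball c ?\<rho>) a3"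
      using f hol sub(1) by (auto intro: holomorphic_to_sphere_subset)
  qed (use sub sep ne K assms in auto)
qed

lemma cross_ratio_bound_of_omitting:
  assumes "R > 0" "\<epsilon> > 0" and f: "holomorphic_to_sphere (ball c R) f" and t: "separated_triple \<epsilon> (ball c R) a1 a2 a3"
    and ne: "\<And>z. z \<in> ball c R \<Longrightarrow> f z \<noteq> a1 z \<and> f z \<noteq> a2 z \<and> f z \<noteq> a3 z"
    and c: "cmod (cross_ratio (f c) (a1 c) (a2 c) (a3 c)) \<le> 2" and z: "z \<in> ball c (R/4)"
  shows "cmod (cross_ratio (f z) (a1 z) (a2 z) (a3 z)) \<le> schottky_bound"
proof (rule schottky_ball[where f = "\<lambda>z. cross_ratio (f z) (a1 z) (a2 z) (a3 z)", OF _ assms(1) c _ z])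
  note d = separated_triple_ne[OF t assms(2)]
  show "(\<lambda>z. cross_ratio (f z) (a1 z) (a2 z) (a3 z)) holomorphic_on ball c R"
    using t f ne d unfolding separated_triple_def by (intro holomorphic_cross_ratio) auto
  fix w assume w: "w \<in> ball c R"
  show "cross_ratio (f w) (a1 w) (a2 w) (a3 w) \<noteq> 0 \<and> cross_ratio (f w) (a1 w) (a2 w) (a3 w) \<noteq> 1"
    using ne[OF w] d[OF w] cross_ratio_eq_0_iff[of "a3 w" "a2 w" "a1 w" "f w"]
      cross_ratio_eq_1_iff[of "a1 w" "a2 w" "a3 w" "f w"] by auto
qed

text \<open>A quantitative form of the theorem of Montel and Caratheodory with wandering exceptional functions. If the cross
ratio is large at the centre, exchanging \<open>a1\<close> and \<open>a2\<close> replaces it by its reciprocal.\<close>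

lemma bounded_lift_omitting:
  assumes "R > 0" "\<epsilon> > 0"
  obtains \<rho> M m where "\<rho> > 0" "m > 0"
    "\<And>f a1 a2 a3 c. holomorphic_to_sphere (ball c R) f \<Longrightarrow> separated_triple \<epsilon> (ball c R) a1 a2 a3 \<Longrightarrow>
       (\<And>z. z \<in> ball c R \<Longrightarrow> f z \<noteq> a1 z \<and> f z \<noteq> a2 z \<and> f z \<noteq> a3 z) \<Longrightarrow>
       bounded_lift M m (ball c \<rho>) f"
proof -
  have "R/4 > 0" using assms by simp
  from bounded_lift_uniform[OF assms this] obtain \<rho> M m where \<rho>: "\<rho> > 0" "m > 0" and
    *: "\<And>f a1 a2 a3 c. holomorphic_to_sphere (ball c R) f \<Longrightarrow> separated_triple \<epsilon> (ball c R) a1 a2 a3 \<Longrightarrow>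
       (\<And>z. z \<in> ball c R \<Longrightarrow> f z \<noteq> a2 z) \<Longrightarrow>
       (\<And>z. z \<in> ball c (R/4) \<Longrightarrow> cmod (cross_ratio (f z) (a1 z) (a2 z) (a3 z)) \<le> schottky_bound) \<Longrightarrow>
       bounded_lift M m (ball c \<rho>) f" by metis
  show ?thesis
  proof (rule that[OF \<rho>])
    fix f a1 a2 a3 c
    assume f: "holomorphic_to_sphere (ball c R) f" and t: "separated_triple \<epsilon> (ball c R) a1 a2 a3"
      and ne: "\<And>z. z \<in> ball c R \<Longrightarrow> f z \<noteq> a1 z \<and> f z \<noteq> a2 z \<and> f z \<noteq> a3 z"
    show "bounded_lift M m (ball c \<rho>) f"
    proof (cases "cmod (cross_ratio (f c) (a1 c) (a2 c) (a3 c)) \<le> 2")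
      case True
      show ?thesis
        using ne cross_ratio_bound_of_omitting[OF assms f t ne True] by (intro *[OF f t]) auto
    next
      case False
      note t' = separated_triple_permute(1)[OF t]
      have "cmod (cross_ratio (f c) (a2 c) (a1 c) (a3 c)) \<le> 2"
        unfolding cross_ratio_swap[of "f c" "a2 c" "a1 c"] norm_divide using False by (simp add: divide_le_eq)
      with ne show ?thesis
        using cross_ratio_bound_of_omitting[OF assms f t'] by (intro *[OF f t']) auto
    qed
  qed
qed

text \<open>The cross ratio now vanishes at the centre, and \<open>schottky_isolated_zero\<close> takes the place of Schottky's
theorem on the disc.\<close>

lemma bounded_lift_isolated:
  assumes "R > 0" "\<epsilon> > 0"
  obtains \<rho> M m where "\<rho> > 0" "m > 0"
    "\<And>f a1 a2 a3 c. holomorphic_to_sphere (ball c R) f \<Longrightarrow> separated_triple \<epsilon> (ball c R) a1 a2 a3 \<Longrightarrow>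
       f c = a1 c \<Longrightarrow> (\<And>z. z \<in> ball c R \<Longrightarrow> z \<noteq> c \<Longrightarrow> f z \<noteq> a1 z) \<Longrightarrow>
       (\<And>z. z \<in> ball c R \<Longrightarrow> f z \<noteq> a2 z \<and> f z \<noteq> a3 z) \<Longrightarrow>
       bounded_lift M m (ball c \<rho>) f"
proof -
  have "R * exp (-9) > 0" using assms by simp
  from bounded_lift_uniform[OF assms this] obtain \<rho> M m where \<rho>: "\<rho> > 0" "m > 0" and
    *: "\<And>f a1 a2 a3 c. holomorphic_to_sphere (ball c R) f \<Longrightarrow> separated_triple \<epsilon> (ball c R) a1 a2 a3 \<Longrightarrow>
       (\<And>z. z \<in> ball c R \<Longrightarrow> f z \<noteq> a2 z) \<Longrightarrow>
       (\<And>z. z \<in> ball c (R * exp (-9)) \<Longrightarrow> cmod (cross_ratio (f z) (a1 z) (a2 z) (a3 z)) \<le> schottky_bound) \<Longrightarrow>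
       bounded_lift M m (ball c \<rho>) f" by metis
  show ?thesis
  proof (rule that[OF \<rho>])
    fix f a1 a2 a3 c
    assume f: "holomorphic_to_sphere (ball c R) f" and t: "separated_triple \<epsilon> (ball c R) a1 a2 a3"
      and c: "f c = a1 c" and ne1: "\<And>z. z \<in> ball c R \<Longrightarrow> z \<noteq> c \<Longrightarrow> f z \<noteq> a1 z"
      and ne: "\<And>z. z \<in> ball c R \<Longrightarrow> f z \<noteq> a2 z \<and> f z \<noteq> a3 z"
    note d = separated_triple_ne[OF t assms(2)]
    show "bounded_lift M m (ball c \<rho>) f"
    proof (rule *[OF f t])
      fix z assume "z \<in> ball c (R * exp (-9))"
      then show "cmod (cross_ratio (f z) (a1 z) (a2 z) (a3 z)) \<le> schottky_bound"
      proof (rule schottky_isolated_zero[where L = "\<lambda>z. cross_ratio (f z) (a1 z) (a2 z) (a3 z)", OF _ assms(1), rotated -1])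
        show "(\<lambda>z. cross_ratio (f z) (a1 z) (a2 z) (a3 z)) holomorphic_on ball c R"
          using t f ne d unfolding separated_triple_def by (intro holomorphic_cross_ratio) auto
        show "cross_ratio (f c) (a1 c) (a2 c) (a3 c) = 0" by (simp add: cross_ratio_def c)
        fix w assume w: "w \<in> ball c R"
        show "cross_ratio (f w) (a1 w) (a2 w) (a3 w) \<noteq> 1"
          using ne[OF w] d[OF w] cross_ratio_eq_1_iff[of "a1 w" "a2 w" "a3 w" "f w"] by auto
        show "cross_ratio (f w) (a1 w) (a2 w) (a3 w) \<noteq> 0" if "w \<noteq> c"
          using ne[OF w] ne1[OF w that] d[OF w] cross_ratio_eq_0_iff[of "a3 w" "a2 w" "a1 w" "f w"] by auto
      qed
    qed (use ne in auto)
  qed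
qed

section \<open>Families that share their coincidence sets\<close>

text \<open>Coincidences are the zeros of the wedge product of two lifts, a holomorphic function; hence they are locally
absent, everywhere, or isolated.\<close>

lemma coincidence_trichotomy:
  assumes "holomorphic_to_sphere {c} u" "holomorphic_to_sphere {c} v"
  obtains r where "r > 0" "\<And>z. z \<in> ball c r \<Longrightarrow> u z \<noteq> v z"
  | r where "r > 0" "\<And>z. z \<in> ball c r \<Longrightarrow> u z = v z"
  | r where "r > 0" "u c = v c" "\<And>z. z \<in> ball c r \<Longrightarrow> z \<noteq> c \<Longrightarrow> u z \<noteq> v z"
proof -
  obtain r1 U where U: "r1 > 0" "lift_on (ball c r1) u U"
    using assms(1) unfolding holomorphic_to_sphere_def by blast
  obtain r2 V where V: "r2 > 0" "lift_on (ball c r2) v V"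
    using assms(2) unfolding holomorphic_to_sphere_def by blast
  define r where "r = min r1 r2"
  have r: "r > 0" using U V by (simp add: r_def)
  have U': "lift_on (ball c r) u U" and V': "lift_on (ball c r) v V"
    by (rule lift_on_subset[OF U(2)], force simp: r_def, rule lift_on_subset[OF V(2)], force simp: r_def)
  define h where "h = (\<lambda>z. wedge (U z) (V z))"
  have h: "h holomorphic_on ball c r" using U' V' unfolding h_def lift_on_def by (auto intro: holomorphic_wedge)
  have iff: "u z = v z \<longleftrightarrow> h z = 0" if "z \<in> ball c r" for z
    using U' V' that point_eq_iff[of "U z" "V z"] by (auto simp: lift_on_def h_def)
  show ?thesis
  proof (cases "\<forall>z\<in>ball c r. h z = 0")
    case True
    then show ?thesis using that(2)[OF r] iff by auto
  next
    case False
    then obtain w where w: "w \<in> ball c r" "h w \<noteq> 0" by auto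
    have c: "c \<in> ball c r" using r by simp
    show ?thesis
    proof (cases "h c = 0")
      case True
      obtain e where e: "0 < e" "ball c e \<subseteq> ball c r" "\<And>z. z \<in> ball c e - {c} \<Longrightarrow> h z \<noteq> 0"
        using isolated_zeros[OF h open_ball connected_ball c True w] by metis
      then show ?thesis using that(3)[OF e(1)] iff True c by (metis DiffI singletonD subsetD)
    next
      case False
      have "continuous_on (ball c r) h" using h holomorphic_on_imp_continuous_on by blast
      then obtain e where e: "e > 0" "\<And>z. z \<in> ball c r \<Longrightarrow> dist z c < e \<Longrightarrow> h z \<noteq> 0"
        using continuous_on_avoid[where f = h, OF _ c False] by (metis dist_commute)
      show ?thesis
        by (rule that(1)[of "min e r"]) (use e r iff in \<open>auto simp: dist_commute\<close>)
    qed
  qed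
qed

text \<open>Sharing makes the kind of coincidence at \<open>c\<close>, and the disc on which it is seen, the same for all members of
the family, so both can be taken from a single member \<open>i0\<close>. Separation keeps \<open>b2\<close> and \<open>b3\<close> away from a
coincidence with \<open>b1\<close>. If the coincidence is not isolated, every member equals its own \<open>b1\<close> near \<open>c\<close> and is thus
itself separated from \<open>b2\<close>.\<close>

lemma uniformly_liftable_of_coincidence:
  fixes u b1 b2 b3 :: "'i \<Rightarrow> complex \<Rightarrow> riemann_sphere"
  assumes "R > 0" "\<epsilon> > 0" "i0 \<in> I"
    and u: "\<And>i. i \<in> I \<Longrightarrow> holomorphic_to_sphere (ball c R) (u i)"
    and t: "\<And>i. i \<in> I \<Longrightarrow> separated_triple \<epsilon> (ball c R) (b1 i) (b2 i) (b3 i)"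
    and sh1: "\<And>i z. i \<in> I \<Longrightarrow> z \<in> ball c R \<Longrightarrow> u i z = b1 i z \<longleftrightarrow> u i0 z = b1 i0 z"
    and sh2: "\<And>i z. i \<in> I \<Longrightarrow> z \<in> ball c R \<Longrightarrow> u i z = b2 i z \<longleftrightarrow> u i0 z = b2 i0 z"
    and sh3: "\<And>i z. i \<in> I \<Longrightarrow> z \<in> ball c R \<Longrightarrow> u i z = b3 i z \<longleftrightarrow> u i0 z = b3 i0 z"
    and c: "u i0 c = b1 i0 c"
  shows "\<exists>\<rho>>0. \<exists>M. \<exists>m>0. \<forall>i\<in>I. bounded_lift M m (ball c \<rho>) (u i)"
proof -
  have cR: "{c} \<subseteq> ball c R" using assms(1) by auto
  have h: "holomorphic_to_sphere {c} (u i0)" "holomorphic_to_sphere {c} (b1 i0)"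
      "holomorphic_to_sphere {c} (b2 i0)" "holomorphic_to_sphere {c} (b3 i0)"
    using u[OF assms(3)] t[OF assms(3)] holomorphic_to_sphere_subset[OF _ cR]
    unfolding separated_triple_def by auto
  have ne: "u i0 c \<noteq> b2 i0 c" "u i0 c \<noteq> b3 i0 c"
    using separated_triple_ne[OF t[OF assms(3)] assms(2), of c] c assms(1) by auto
  obtain r2 where r2: "r2 > 0" "\<And>z. z \<in> ball c r2 \<Longrightarrow> u i0 z \<noteq> b2 i0 z"
    by (rule coincidence_trichotomy[OF h(1,3)]) (use ne in force)+
  obtain r3 where r3: "r3 > 0" "\<And>z. z \<in> ball c r3 \<Longrightarrow> u i0 z \<noteq> b3 i0 z"
    by (rule coincidence_trichotomy[OF h(1,4)]) (use ne in force)+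
  obtain r1 where r1: "r1 > 0" "(\<forall>z\<in>ball c r1. u i0 z = b1 i0 z) \<or> (\<forall>z\<in>ball c r1. z \<noteq> c \<longrightarrow> u i0 z \<noteq> b1 i0 z)"
    by (rule coincidence_trichotomy[OF h(1,2)]) (use c in force)+
  define r where "r = min R (min r1 (min r2 r3))"
  have r: "r > 0" using assms(1) r1 r2 r3 by (simp add: r_def)
  have sub: "ball c r \<subseteq> ball c R" "ball c r \<subseteq> ball c r1" "ball c r \<subseteq> ball c r2" "ball c r \<subseteq> ball c r3"
    by (auto simp: r_def)
  have u': "holomorphic_to_sphere (ball c r) (u i)" if "i \<in> I" for i
    using holomorphic_to_sphere_subset[OF u[OF that] sub(1)] .
  have t': "separated_triple \<epsilon> (ball c r) (b1 i) (b2 i) (b3 i)" if "i \<in> I" for i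
    using separated_triple_subset[OF t[OF that] sub(1)] .
  have ne23: "u i z \<noteq> b2 i z \<and> u i z \<noteq> b3 i z" if "i \<in> I" "z \<in> ball c r" for i z
    using that sh2[OF that(1)] sh3[OF that(1)] r2 r3 sub by blast
  from r1(2) show ?thesis
  proof
    assume eq: "\<forall>z\<in>ball c r1. u i0 z = b1 i0 z"
    have "bounded_lift (pi / \<epsilon>) (1/4) (ball c (min r (r * \<epsilon> / (12 * pi)))) (u i)" if i: "i \<in> I" for i
    proof (rule bounded_lift_of_separated[OF r assms(2) u'[OF i]])
      show "holomorphic_to_sphere (ball c r) (b2 i)" using t'[OF i] by (simp add: separated_triple_def)
      fix z assume z: "z \<in> ball c r"
      have "u i z = b1 i z" using sh1[OF i, of z] eq z sub by blast
      then show "\<epsilon> \<le> dist (u i z) (b2 i z)" using t'[OF i] z by (simp add: separated_triple_def)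
    qed
    moreover have "min r (r * \<epsilon> / (12 * pi)) > 0" using r assms(2) by simp
    ultimately show ?thesis
      by (intro exI[of _ "min r (r * \<epsilon> / (12 * pi))"] conjI exI[of _ "pi / \<epsilon>"] exI[of _ "1/4"]) auto
  next
    assume iso: "\<forall>z\<in>ball c r1. z \<noteq> c \<longrightarrow> u i0 z \<noteq> b1 i0 z"
    from bounded_lift_isolated[OF r assms(2)] obtain \<rho> M m where \<rho>: "\<rho> > 0" "m > 0" and
      *: "\<And>f a1 a2 a3 c. holomorphic_to_sphere (ball c r) f \<Longrightarrow> separated_triple \<epsilon> (ball c r) a1 a2 a3 \<Longrightarrow>
         f c = a1 c \<Longrightarrow> (\<And>z. z \<in> ball c r \<Longrightarrow> z \<noteq> c \<Longrightarrow> f z \<noteq> a1 z) \<Longrightarrow>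
         (\<And>z. z \<in> ball c r \<Longrightarrow> f z \<noteq> a2 z \<and> f z \<noteq> a3 z) \<Longrightarrow>
         bounded_lift M m (ball c \<rho>) f" by metis
    have "bounded_lift M m (ball c \<rho>) (u i)" if i: "i \<in> I" for i
    proof (rule *[OF u'[OF i] t'[OF i] _ _ ne23[OF i]])
      show "u i c = b1 i c" using sh1[OF i, of c] c assms(1) by simp
      show "u i z \<noteq> b1 i z" if "z \<in> ball c r" "z \<noteq> c" for z
        using sh1[OF i, of z] iso that sub by blast
    qed
    then show ?thesis using \<rho> by blast
  qed
qed

lemma locally_uniformly_liftable:
  fixes u a1 a2 a3 :: "'i \<Rightarrow> complex \<Rightarrow> riemann_sphere"
  assumes "R > 0" "\<epsilon> > 0"
    and u: "\<And>i. i \<in> I \<Longrightarrow> holomorphic_to_sphere (ball c R) (u i)"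
    and t: "\<And>i. i \<in> I \<Longrightarrow> separated_triple \<epsilon> (ball c R) (a1 i) (a2 i) (a3 i)"
    and sh1: "\<And>i j z. i \<in> I \<Longrightarrow> j \<in> I \<Longrightarrow> z \<in> ball c R \<Longrightarrow> u i z = a1 i z \<longleftrightarrow> u j z = a1 j z"
    and sh2: "\<And>i j z. i \<in> I \<Longrightarrow> j \<in> I \<Longrightarrow> z \<in> ball c R \<Longrightarrow> u i z = a2 i z \<longleftrightarrow> u j z = a2 j z"
    and sh3: "\<And>i j z. i \<in> I \<Longrightarrow> j \<in> I \<Longrightarrow> z \<in> ball c R \<Longrightarrow> u i z = a3 i z \<longleftrightarrow> u j z = a3 j z"
  shows "\<exists>\<rho>>0. \<exists>M. \<exists>m>0. \<forall>i\<in>I. bounded_lift M m (ball c \<rho>) (u i)"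
proof (cases "I = {}")
  case True
  then show ?thesis by (auto intro: exI[of _ 1])
next
  case False
  then obtain i0 where i0: "i0 \<in> I" by auto
  note co = uniformly_liftable_of_coincidence[where u = u, OF assms(1,2) i0]
  note t2 = separated_triple_permute(1)[OF t] and t3 = separated_triple_permute(2)[OF t]
  consider "u i0 c = a1 i0 c" | "u i0 c = a2 i0 c" | "u i0 c = a3 i0 c"
    | (none) "u i0 c \<noteq> a1 i0 c" "u i0 c \<noteq> a2 i0 c" "u i0 c \<noteq> a3 i0 c" by blast
  then show ?thesis
  proof cases
    case 1
    show ?thesis using sh1[OF _ i0] sh2[OF _ i0] sh3[OF _ i0] 
      by (intro co[where ?b1.0 = a1 and ?b2.0 = a2 and ?b3.0 = a3, OF u t _ _ _ 1]) auto
  next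
    case 2
    show ?thesis using sh1[OF _ i0] sh2[OF _ i0] sh3[OF _ i0] 
      by (intro co[where ?b1.0 = a2 and ?b2.0 = a1 and ?b3.0 = a3, OF u t2 _ _ _ 2]) auto
  next
    case 3
    show ?thesis using sh1[OF _ i0] sh2[OF _ i0] sh3[OF _ i0] 
      by (intro co[where ?b1.0 = a3 and ?b2.0 = a1 and ?b3.0 = a2, OF u t3 _ _ _ 3]) auto
  next
    case none
    have cR: "{c} \<subseteq> ball c R" using assms(1) by auto
    have h: "holomorphic_to_sphere {c} (u i0)" "holomorphic_to_sphere {c} (a1 i0)"
        "holomorphic_to_sphere {c} (a2 i0)" "holomorphic_to_sphere {c} (a3 i0)"
      using u[OF i0] t[OF i0] holomorphic_to_sphere_subset[OF _ cR]
      unfolding separated_triple_def by auto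
    obtain r1 where r1: "r1 > 0" "\<And>z. z \<in> ball c r1 \<Longrightarrow> u i0 z \<noteq> a1 i0 z"
      by (rule coincidence_trichotomy[OF h(1,2)]) (use none in force)+
    obtain r2 where r2: "r2 > 0" "\<And>z. z \<in> ball c r2 \<Longrightarrow> u i0 z \<noteq> a2 i0 z"
      by (rule coincidence_trichotomy[OF h(1,3)]) (use none in force)+
    obtain r3 where r3: "r3 > 0" "\<And>z. z \<in> ball c r3 \<Longrightarrow> u i0 z \<noteq> a3 i0 z"
      by (rule coincidence_trichotomy[OF h(1,4)]) (use none in force)+
    define r where "r = min R (min r1 (min r2 r3))"
    have r: "r > 0" using assms(1) r1 r2 r3 by (simp add: r_def)
    have sub: "ball c r \<subseteq> ball c R" "ball c r \<subseteq> ball c r1" "ball c r \<subseteq> ball c r2" "ball c r \<subseteq> ball c r3"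
      by (auto simp: r_def)
    from bounded_lift_omitting[OF r assms(2)] obtain \<rho> M m where \<rho>: "\<rho> > 0" "m > 0" and
      *: "\<And>f a1 a2 a3 c. holomorphic_to_sphere (ball c r) f \<Longrightarrow> separated_triple \<epsilon> (ball c r) a1 a2 a3 \<Longrightarrow>
       (\<And>z. z \<in> ball c r \<Longrightarrow> f z \<noteq> a1 z \<and> f z \<noteq> a2 z \<and> f z \<noteq> a3 z) \<Longrightarrow>
       bounded_lift M m (ball c \<rho>) f" by metis
    have "bounded_lift M m (ball c \<rho>) (u i)" if i: "i \<in> I" for i
    proof (rule *)
      show "holomorphic_to_sphere (ball c r) (u i)"
        using holomorphic_to_sphere_subset[OF u[OF i] sub(1)] .
      show "separated_triple \<epsilon> (ball c r) (a1 i) (a2 i) (a3 i)"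
        using separated_triple_subset[OF t[OF i] sub(1)] .
      show "u i z \<noteq> a1 i z \<and> u i z \<noteq> a2 i z \<and> u i z \<noteq> a3 i z" if z: "z \<in> ball c r" for z
        using z sub r1 r2 r3 sh1[OF i i0] sh2[OF i i0] sh3[OF i i0] by blast
    qed
    then show ?thesis using \<rho> by blast
  qed
qed

section \<open>Compactness of families with bounded lifts\<close>

lemma dist_point_le:
  assumes "m > 0" "m \<le> norm v" "w \<noteq> 0"
  shows "dist (point v) (point w) \<le> pi / m * norm (v - w)"
proof -
  have v: "v \<noteq> 0" using assms by auto
  have "wedge v w = wedge (v - w) w" by (simp add: wedge_def algebra_simps)
  then have "cmod (wedge v w) \<le> norm (v - w) * norm w" using norm_wedge_le[of "v - w" w] by simp
  then have "cmod (wedge v w) / (norm v * norm w) \<le> norm (v - w) * norm w / (norm v * norm w)"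
    by (rule divide_right_mono) simp
  also have "\<dots> = norm (v - w) / norm v" using assms(3) by simp
  also have "\<dots> \<le> norm (v - w) / m" using assms v by (intro divide_left_mono mult_pos_pos) auto
  finally have "pi * (cmod (wedge v w) / (norm v * norm w)) \<le> pi * (norm (v - w) / m)"
    by (rule mult_left_mono) simp
  then show ?thesis using dist_le_chord[OF v assms(3)] by simp
qed

text \<open>Montel's theorem, applied to both components of the lifts in turn. The limit pair inherits the lower bound, so
it represents a point everywhere.\<close>

lemma uniform_subsequence_of_bounded_lifts:
  assumes "\<rho> > 0" "m > 0" and bl: "\<And>n::nat. bounded_lift M m (ball c \<rho>) (u n)"
  obtains k g where "strict_mono (k :: nat \<Rightarrow> nat)" "holomorphic_to_sphere (ball c \<rho>) g"
    "uniform_limit (ball c (\<rho>/2)) (\<lambda>n. u (k n)) g sequentially"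
proof -
  obtain v where v: "\<And>n. lift_on (ball c \<rho>) (u n) (v n)"
    and b: "\<And>n z. z \<in> ball c \<rho> \<Longrightarrow> norm (v n z) \<le> M \<and> m \<le> norm (v n z)"
    using bl unfolding bounded_lift_def by metis
  define H where "H = {h. h holomorphic_on ball c \<rho> \<and> (\<forall>z\<in>ball c \<rho>. cmod (h z) \<le> M)}"
  have H: "\<And>h. h \<in> H \<Longrightarrow> h holomorphic_on ball c \<rho>"
    "\<And>K. compact K \<Longrightarrow> K \<subseteq> ball c \<rho> \<Longrightarrow> \<exists>B. \<forall>h\<in>H. \<forall>z\<in>K. cmod (h z) \<le> B"
    by (auto simp: H_def)
  have le: "cmod (fst x) \<le> norm x" "cmod (snd x) \<le> norm x" for x :: "complex \<times> complex"
    using norm_fst_le[of "fst x" "snd x"] norm_snd_le[of "snd x" "fst x"] by auto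
  have 1: "range (\<lambda>n z. fst (v n z)) \<subseteq> H" "range (\<lambda>n z. snd (v n z)) \<subseteq> H"
    using v b unfolding H_def lift_on_def holomorphic_pair_def by (auto intro: order_trans[OF le(1)] order_trans[OF le(2)])
  obtain g1 k1 where g1: "g1 holomorphic_on ball c \<rho>" "strict_mono (k1 :: nat \<Rightarrow> nat)"
    "\<And>x. x \<in> ball c \<rho> \<Longrightarrow> (\<lambda>n. fst (v (k1 n) x)) \<longlonglongrightarrow> g1 x"
    "\<And>K. compact K \<Longrightarrow> K \<subseteq> ball c \<rho> \<Longrightarrow> uniform_limit K ((\<lambda>n z. fst (v n z)) \<circ> k1) g1 sequentially"
    using Montel[OF open_ball H 1(1)] by metis
  have 2: "range (\<lambda>n z. snd (v (k1 n) z)) \<subseteq> H" using 1(2) by auto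
  obtain g2 k2 where g2: "g2 holomorphic_on ball c \<rho>" "strict_mono (k2 :: nat \<Rightarrow> nat)"
    "\<And>x. x \<in> ball c \<rho> \<Longrightarrow> (\<lambda>n. snd (v (k1 (k2 n)) x)) \<longlonglongrightarrow> g2 x"
    "\<And>K. compact K \<Longrightarrow> K \<subseteq> ball c \<rho> \<Longrightarrow> uniform_limit K ((\<lambda>n z. snd (v (k1 n) z)) \<circ> k2) g2 sequentially"
    using Montel[OF open_ball H 2] by metis
  define k where "k = k1 \<circ> k2"
  define V where "V = (\<lambda>z. (g1 z, g2 z))"
  have k: "strict_mono k" unfolding k_def using g1(2) g2(2) by (rule strict_mono_o)
  have lim1: "(\<lambda>n. fst (v (k n) x)) \<longlonglongrightarrow> g1 x" if "x \<in> ball c \<rho>" for x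
    using LIMSEQ_subseq_LIMSEQ[OF g1(3)[OF that] g2(2)] by (simp add: k_def o_def)
  have V: "m \<le> norm (V x)" if x: "x \<in> ball c \<rho>" for x
  proof -
    have "(\<lambda>n. (fst (v (k n) x), snd (v (k n) x))) \<longlonglongrightarrow> V x"
      unfolding V_def using lim1[OF x] g2(3)[OF x] by (intro tendsto_Pair) (auto simp: k_def)
    then have "(\<lambda>n. norm (v (k n) x)) \<longlonglongrightarrow> norm (V x)" by (auto dest: tendsto_norm)
    then show ?thesis using b[OF x] by (intro LIMSEQ_le_const) auto
  qed
  have V0: "V x \<noteq> 0" if "x \<in> ball c \<rho>" for x using V[OF that] assms(2) by auto
  have "lift_on (ball c \<rho>) (\<lambda>z. point (V z)) V"
    unfolding lift_on_def holomorphic_pair_def using V0 g1(1) g2(1) by (auto simp: V_def)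
  then have hol: "holomorphic_to_sphere (ball c \<rho>) (\<lambda>z. point (V z))"
    unfolding holomorphic_to_sphere_def by (meson lift_on_subset open_ball open_contains_ball)
  have cb: "compact (cball c (\<rho>/2))" "cball c (\<rho>/2) \<subseteq> ball c \<rho>" using assms(1) by auto
  have "uniform_limit (ball c (\<rho>/2)) (\<lambda>n. u (k n)) (\<lambda>z. point (V z)) sequentially"
    unfolding uniform_limit_iff
  proof (intro allI impI)
    fix e :: real assume e: "e > 0"
    define d where "d = e * m / (2 * pi)"
    have d: "d > 0" using e assms(2) by (simp add: d_def)
    have "\<forall>\<^sub>F n in sequentially. \<forall>x\<in>cball c (\<rho>/2). dist (fst (v (k1 n) x)) (g1 x) < d"
      using uniform_limitD[OF g1(4)[OF cb] d] by simp
    then have E1: "\<forall>\<^sub>F n in sequentially. \<forall>x\<in>cball c (\<rho>/2). dist (fst (v (k n) x)) (g1 x) < d"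
      unfolding k_def o_def using eventually_subseq[OF g2(2)] by blast
    have E2: "\<forall>\<^sub>F n in sequentially. \<forall>x\<in>cball c (\<rho>/2). dist (snd (v (k n) x)) (g2 x) < d"
      using uniform_limitD[OF g2(4)[OF cb] d] by (simp add: k_def)
    from E1 E2 show "\<forall>\<^sub>F n in sequentially. \<forall>x\<in>ball c (\<rho>/2). dist (u (k n) x) (point (V x)) < e"
    proof eventually_elim
      case (elim n)
      show ?case
      proof
        fix x assume "x \<in> ball c (\<rho>/2)"
        then have x: "x \<in> cball c (\<rho>/2)" "x \<in> ball c \<rho>" using assms(1) by auto
        have "norm (v (k n) x - V x) \<le> cmod (fst (v (k n) x) - g1 x) + cmod (snd (v (k n) x) - g2 x)"
          using norm_Pair_le[of "fst (v (k n) x) - g1 x" "snd (v (k n) x) - g2 x"]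
          by (simp add: V_def minus_prod_def)
        also have "\<dots> < d + d"
          using bspec[OF elim(1) x(1)] bspec[OF elim(2) x(1)] unfolding dist_norm by (rule add_strict_mono)
        finally have *: "pi / m * norm (v (k n) x - V x) < pi / m * (2 * d)"
          using assms(2) by (intro mult_strict_left_mono) auto
        have "u (k n) x = point (v (k n) x)" using v x(2) by (auto simp: lift_on_def)
        then have "dist (u (k n) x) (point (V x)) \<le> pi / m * norm (v (k n) x - V x)"
          using dist_point_le[OF assms(2) _ V0[OF x(2)]] b[OF x(2)] by simp
        also note *
        also have "pi / m * (2 * d) = e" using assms(2) by (simp add: d_def)
        finally show "dist (u (k n) x) (point (V x)) < e" .
      qed
    qed
  qed
  from that[OF k hol this] show ?thesis .
qed

section \<open>Charts of the sphere\<close>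

lemma continuous_on_to_unit_sphere: "continuous_on A to_unit_sphere"
  unfolding continuous_on_iff using dist_to_unit_sphere_le le_less_trans by blast

lemma continuous_on_Finite: "continuous_on A Finite"
  unfolding continuous_on_iff
proof (intro ballI allI impI)
  fix z and e :: real assume e: "e > 0"
  have "dist (Finite w) (Finite z) \<le> pi * dist w z" for w
    using dist_point_le[of 1 "(w, 1)" "(z, 1)"] norm_snd_le[of "1::complex" w]
    by (auto simp: point_def zero_prod_def norm_Pair dist_norm)
  then have "dist (Finite w) (Finite z) < e" if "dist w z < e / pi" for w
    using that by (simp add: less_divide_eq mult.commute) (meson le_less_trans)
  then show "\<exists>d>0. \<forall>w\<in>A. dist w z < d \<longrightarrow> dist (Finite w) (Finite z) < e"
    using e by (intro exI[of _ "e / pi"]) auto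
qed

lemma stereographic_projection:
  "fst (to_unit_sphere (Finite z)) / of_real (1 - snd (to_unit_sphere (Finite z))) = z"
  "snd (to_unit_sphere (Finite z)) \<noteq> 1"
proof -
  have N: "(cmod z)\<^sup>2 + 1 \<noteq> 0" by (smt (verit) zero_le_power2)
  then have *: "1 - snd (to_unit_sphere (Finite z)) = 2 / ((cmod z)\<^sup>2 + 1)" by (simp add: field_simps)
  show "fst (to_unit_sphere (Finite z)) / of_real (1 - snd (to_unit_sphere (Finite z))) = z"
    unfolding * using N by (simp add: scaleR_conv_of_real del: of_real_add of_real_power of_real_divide)
  show "snd (to_unit_sphere (Finite z)) \<noteq> 1" using * N by auto
qed

text \<open>On the finite points \<open>finite_part\<close> is stereographic projection, which makes \<open>Finite\<close> an open map.\<close>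

lemma continuous_on_finite_part: "continuous_on (- {Infty}) finite_part"
proof -
  have "continuous_on (- {Infty}) (\<lambda>x. fst (to_unit_sphere x) / of_real (1 - snd (to_unit_sphere x)))"
  proof (intro continuous_intros continuous_on_to_unit_sphere ballI)
    fix x assume "x \<in> - {Infty}"
    then show "complex_of_real (1 - snd (to_unit_sphere x)) \<noteq> 0"
      using stereographic_projection(2) by (cases x) (auto simp del: to_unit_sphere.simps)
  qed
  moreover have "fst (to_unit_sphere x) / of_real (1 - snd (to_unit_sphere x)) = finite_part x"
    if "x \<in> - {Infty}" for x
    using that stereographic_projection(1) by (cases x) (auto simp del: to_unit_sphere.simps)
  ultimately show ?thesis by (rule continuous_on_eq)
qed

lemma open_image_Finite:
  assumes "open U"
  shows "open (Finite ` U)"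
proof -
  have "Finite ` U = - {Infty} \<inter> finite_part -` U"
  proof (intro set_eqI iffI)
    fix x assume "x \<in> - {Infty} \<inter> finite_part -` U"
    then show "x \<in> Finite ` U" by (cases x) auto
  qed auto
  then show ?thesis
    using continuous_open_preimage[OF continuous_on_finite_part _ assms] by auto
qed

lemma sphere_inverse_involution [simp]: "sphere_inverse (sphere_inverse x) = x"
  by (cases x) auto

text \<open>Inversion exchanges the two homogeneous coordinates and so preserves wedge products up to sign.\<close>

lemma dist_sphere_inverse: "dist (sphere_inverse x) (sphere_inverse y) = dist x y"
proof -
  have p: "sphere_inverse x = point (snd (coords x), fst (coords x))" for x
    by (cases x) (auto simp: point_def)
  have n: "(snd (coords x), fst (coords x)) \<noteq> 0" for x by (cases x) (auto simp: zero_prod_def)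
  have N: "norm (snd (coords x), fst (coords x)) = norm (coords x)" for x
    by (simp add: norm_prod_def add.commute)
  have w: "cmod (wedge (snd (coords x), fst (coords x)) (snd (coords y), fst (coords y))) = cmod (wedge (coords x) (coords y))"
    by (simp add: wedge_def norm_minus_commute mult.commute)
  show ?thesis
    unfolding dist_riemann_sphere_def p inner_to_unit_sphere_point[OF n n] N w
    using inner_to_unit_sphere_point[OF coords_nonzero coords_nonzero, of x y] by simp
qed

lemma continuous_on_sphere_inverse: "continuous_on A sphere_inverse"
  unfolding continuous_on_iff dist_sphere_inverse by blast

text \<open>The charts are centred at \<open>finite_part z\<close>; this is \<open>0\<close> for \<open>z = Infty\<close>, as it should be for the inverted
coordinate. They are the coordinates in which \<open>meromorphic_at\<close> is defined.\<close>

primrec chart :: "riemann_sphere \<Rightarrow> complex \<Rightarrow> riemann_sphere" where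
  "chart (Finite z) = Finite"
| "chart Infty = (\<lambda>w. sphere_inverse (Finite w))"

lemma chart_center [simp]: "chart z (finite_part z) = z"
  by (cases z) auto

lemma continuous_on_chart: "continuous_on A (chart z)"
proof (cases z)
  case Infty
  have "continuous_on A (sphere_inverse \<circ> Finite)"
    by (intro continuous_on_compose continuous_on_Finite continuous_on_sphere_inverse)
  then show ?thesis by (simp add: Infty o_def)
qed (simp add: continuous_on_Finite)

lemma open_image_chart:
  assumes "open U"
  shows "open (chart z ` U)"
proof (cases z)
  case Infty
  have "chart z ` U = sphere_inverse -` (Finite ` U)"
    by (auto simp: Infty image_iff simp del: sphere_inverse.simps) (metis sphere_inverse_involution)
  then show ?thesis
    using continuous_on_open_vimage[of UNIV sphere_inverse] continuous_on_sphere_inverse open_image_Finite[OF assms]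
    by auto
qed (simp add: open_image_Finite assms)

text \<open>Away from poles the pair \<open>(f, 1)\<close> is a lift. Near a pole it is \<open>(1, 1 / f)\<close>, with the singularity of \<open>1 / f\<close>
removed.\<close>

lemma lift_of_meromorphic_at_finite:
  assumes "meromorphic_at_finite f z"
  shows "\<exists>r>0. \<exists>v. lift_on (ball z r) (\<lambda>w. f (Finite w)) v"
proof -
  let ?g = "\<lambda>w. finite_part (f (Finite w))"
  have ev: "\<forall>\<^sub>F w in at z. f (Finite w) \<noteq> Infty" using assms by (simp add: meromorphic_at_finite_def)
  then obtain e where e: "e > 0" "\<And>w. w \<in> ball z e \<Longrightarrow> w \<noteq> z \<Longrightarrow> f (Finite w) \<noteq> Infty"
    unfolding eventually_at by (auto simp: dist_commute)
  show ?thesis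
  proof (cases "f (Finite z) = Infty")
    case False
    then obtain r where r: "r > 0" "?g holomorphic_on ball z r"
      using assms unfolding meromorphic_at_finite_def analytic_on_def by auto
    have "lift_on (ball z (min r e)) (\<lambda>w. f (Finite w)) (\<lambda>w. (?g w, 1))"
      unfolding lift_on_def holomorphic_pair_def
    proof (intro conjI ballI)
      show "(\<lambda>w. fst (?g w, 1::complex)) holomorphic_on ball z (min r e)"
        using r(2) by (auto elim: holomorphic_on_subset)
      show "(\<lambda>w. snd (?g w, 1::complex)) holomorphic_on ball z (min r e)" by simp
      fix w assume w: "w \<in> ball z (min r e)"
      show "(?g w, 1::complex) \<noteq> 0" by (simp add: zero_prod_def)
      have "f (Finite w) \<noteq> Infty" using e(2)[of w] w False by auto
      then show "f (Finite w) = point (?g w, 1)" by (cases "f (Finite w)") (auto simp: point_def)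
    qed
    then show ?thesis using r(1) e(1) by (intro exI[of _ "min r e"]) auto
  next
    case True
    then have iso: "isolated_singularity_at ?g z" and pole: "is_pole ?g z"
      using assms unfolding meromorphic_at_finite_def by auto
    obtain r where r: "r > 0" "?g analytic_on ball z r - {z}" using iso unfolding isolated_singularity_at_def by auto
    obtain r2 where r2: "r2 > 0" "\<And>w. w \<in> ball z r2 \<Longrightarrow> w \<noteq> z \<Longrightarrow> ?g w \<noteq> 0"
      using non_zero_neighbour_pole[OF pole] unfolding eventually_at by (auto simp: dist_commute)
    define s where "s = min e (min r r2)"
    have s: "s > 0" using e r r2 by (simp add: s_def)
    have h: "(\<lambda>w. if w = z then 0 else inverse (?g w)) holomorphic_on ball z s"
    proof (rule is_pole_inverse_holomorphic[OF open_ball _ pole])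
      show "?g holomorphic_on ball z s - {z}"
        using analytic_imp_holomorphic[OF r(2)] by (rule holomorphic_on_subset) (auto simp: s_def)
      show "\<forall>x\<in>ball z s - {z}. ?g x \<noteq> 0" using r2(2) by (auto simp: s_def)
    qed
    have "lift_on (ball z s) (\<lambda>w. f (Finite w)) (\<lambda>w. (1, if w = z then 0 else inverse (?g w)))"
      unfolding lift_on_def holomorphic_pair_def
    proof (intro conjI ballI)
      show "(\<lambda>w. fst (1::complex, if w = z then 0 else inverse (?g w))) holomorphic_on ball z s" by simp
      show "(\<lambda>w. snd (1::complex, if w = z then 0 else inverse (?g w))) holomorphic_on ball z s"
        unfolding snd_conv by (rule h)
      fix w assume w: "w \<in> ball z s"
      show "(1::complex, if w = z then 0 else inverse (?g w)) \<noteq> 0" by (simp add: zero_prod_def)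
      show "f (Finite w) = point (1, if w = z then 0 else inverse (?g w))"
      proof (cases "w = z")
        case False
        then have "f (Finite w) \<noteq> Infty" "?g w \<noteq> 0" using e(2)[of w] r2(2)[of w] w by (auto simp: s_def)
        then show ?thesis using False by (cases "f (Finite w)") (auto simp: point_def divide_inverse)
      qed (simp add: True point_def)
    qed
    then show ?thesis using s by blast
  qed
qed

text \<open>A map with a lift \<open>(p, q)\<close> takes the value \<open>Infty\<close> at the zeros of \<open>q\<close>. These are isolated as soon as the map is
not constantly \<open>Infty\<close>, and \<open>p / q\<close> has poles there because \<open>p\<close> and \<open>q\<close> have no common zero.\<close>

lemma meromorphic_at_finite_of_lift:
  assumes "r > 0" "lift_on (ball z r) (\<lambda>w. f (Finite w)) v" and w0: "w0 \<in> ball z r" "f (Finite w0) \<noteq> Infty"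
  shows "meromorphic_at_finite f z"
proof -
  define p q where "p = (\<lambda>w. fst (v w))" and "q = (\<lambda>w. snd (v w))"
  have hp: "p holomorphic_on ball z r" and hq: "q holomorphic_on ball z r"
    using assms(2) by (auto simp: lift_on_def holomorphic_pair_def p_def q_def)
  have val: "f (Finite w) = (if q w = 0 then Infty else Finite (p w / q w))" "p w \<noteq> 0 \<or> q w \<noteq> 0"
    if "w \<in> ball z r" for w
    using assms(2) that by (auto simp: lift_on_def point_def p_def q_def prod_eq_iff)
  have z: "z \<in> ball z r" using assms(1) by simp
  have "q w0 \<noteq> 0" using val[OF w0(1)] w0(2) by auto
  have ev: "\<forall>\<^sub>F w in at z. q w \<noteq> 0 \<and> w \<in> ball z r"
    using non_zero_neighbour_alt[OF hq open_ball connected_ball z w0(1) \<open>q w0 \<noteq> 0\<close>] .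
  then obtain e where e: "e > 0" "\<And>w. w \<in> ball z e \<Longrightarrow> w \<noteq> z \<Longrightarrow> q w \<noteq> 0 \<and> w \<in> ball z r"
    unfolding eventually_at by (auto simp: dist_commute)
  have fin: "\<forall>\<^sub>F w in at z. f (Finite w) \<noteq> Infty"
    using ev by eventually_elim (use val in auto)
  have eq: "finite_part (f (Finite w)) = p w / q w" if "w \<in> ball z r" for w
    using val(1)[OF that] by simp
  show ?thesis
  proof (cases "q z = 0")
    case False
    have "(\<lambda>w. p w / q w) holomorphic_on ball z (min e r)"
      by (intro holomorphic_intros holomorphic_on_subset[OF hp] holomorphic_on_subset[OF hq])
        (use e False in auto)
    then have "(\<lambda>w. finite_part (f (Finite w))) holomorphic_on ball z (min e r)"
      by (rule holomorphic_transform) (simp add: eq)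
    then have "(\<lambda>w. finite_part (f (Finite w))) analytic_on {z}"
      using e(1) assms(1) by (auto simp: analytic_on_def intro!: exI[of _ "min e r"])
    then show ?thesis using fin False val(1)[OF z] by (simp add: meromorphic_at_finite_def)
  next
    case True
    have "(\<lambda>w. p w / q w) holomorphic_on ball z (min e r) - {z}"
      by (intro holomorphic_intros holomorphic_on_subset[OF hp] holomorphic_on_subset[OF hq])
        (use e in auto)
    then have "(\<lambda>w. finite_part (f (Finite w))) holomorphic_on ball z (min e r) - {z}"
      by (rule holomorphic_transform) (simp add: eq)
    then have "(\<lambda>w. finite_part (f (Finite w))) analytic_on ball z (min e r) - {z}"
      by (subst analytic_on_open) auto
    then have iso: "isolated_singularity_at (\<lambda>w. finite_part (f (Finite w))) z"
      using e(1) assms(1) by (auto simp: isolated_singularity_at_def intro!: exI[of _ "min e r"])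
    have cp: "isCont p z" "isCont q z"
      using hp hq z by (meson continuous_on_eq_continuous_at holomorphic_on_imp_continuous_on open_ball)+
    have "filterlim q (at 0) (at z)"
      using cp(2) True ev unfolding filterlim_at isCont_def by (auto elim: eventually_mono)
    then have "is_pole (\<lambda>w. p w / q w) z"
      using cp val(2)[OF z] True by (intro is_pole_divide) auto
    then have "is_pole (\<lambda>w. finite_part (f (Finite w))) z"
      by (subst is_pole_cong[where g = "\<lambda>w. p w / q w" and b = z])
         (use ev eq in \<open>auto elim!: eventually_mono\<close>)
    then show ?thesis using fin iso True val(1)[OF z] by (simp add: meromorphic_at_finite_def)
  qed
qed

lemma holomorphic_to_sphere_chart:
  assumes f: "f \<in> meromorphic_maps D \<union> infinity_maps D" and S: "open S" "chart z ` S \<subseteq> D"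
  shows "holomorphic_to_sphere S (\<lambda>w. f (chart z w))"
  using f
proof
  assume "f \<in> infinity_maps D"
  then have "lift_on S (\<lambda>w. f (chart z w)) (\<lambda>_. (1, 0))"
    using S unfolding lift_on_def holomorphic_pair_def infinity_maps_def by (auto simp: point_def zero_prod_def)
  then show ?thesis
    unfolding holomorphic_to_sphere_def using S(1) by (meson lift_on_subset open_contains_ball)
next
  assume "f \<in> meromorphic_maps D"
  then have m: "meromorphic_at f (chart z w)" if "w \<in> S" for w
    using that S(2) by (auto simp: meromorphic_maps_def)
  show ?thesis
    unfolding holomorphic_to_sphere_def
  proof
    fix w assume w: "w \<in> S"
    show "\<exists>r>0. \<exists>v. lift_on (ball w r) (\<lambda>w. f (chart z w)) v"
    proof (cases z)
      case (Finite x)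
      then show ?thesis using m[OF w] lift_of_meromorphic_at_finite[of f w] by simp
    next
      case Infty
      show ?thesis
      proof (cases "w = 0")
        case True
        then show ?thesis using m[OF w] lift_of_meromorphic_at_finite[of "f \<circ> sphere_inverse" 0]
          by (simp add: Infty o_def)
      next
        case False
        then obtain r v where r: "r > 0" and v: "lift_on (ball (1/w) r) (\<lambda>w. f (Finite w)) v"
          using m[OF w] lift_of_meromorphic_at_finite[of f "1/w"] by (auto simp: Infty)
        have "open (- {0} \<inter> (\<lambda>w. 1/w) -` ball (1/w) r)"
          by (intro continuous_open_preimage continuous_intros) auto
        moreover have "w \<in> - {0} \<inter> (\<lambda>w. 1/w) -` ball (1/w) r" using False r by simp
        ultimately obtain s where s: "s > 0" "ball w s \<subseteq> - {0} \<inter> (\<lambda>w. 1/w) -` ball (1/w) r"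
          by (meson open_contains_ball)
        have s0: "x \<noteq> 0" "1 / x \<in> ball (1/w) r" if "x \<in> ball w s" for x using s(2) that by auto
        have "lift_on (ball w s) (\<lambda>w. f (chart z w)) (\<lambda>x. v (1 / x))"
          unfolding lift_on_def
        proof (intro conjI ballI)
          show "holomorphic_pair (ball w s) (\<lambda>x. v (1 / x))"
          proof (rule holomorphic_pair_compose)
            show "holomorphic_pair (ball (1/w) r) v" using v by (simp add: lift_on_def)
            show "(\<lambda>x. 1 / x) holomorphic_on ball w s" using s0(1) by (intro holomorphic_intros) auto
            show "(\<lambda>x. 1 / x) ` ball w s \<subseteq> ball (1/w) r" using s0(2) by blast
          qed
          fix x assume x: "x \<in> ball w s"
          show "v (1 / x) \<noteq> 0" using v s0(2)[OF x] by (simp add: lift_on_def)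
          show "f (chart z x) = point (v (1 / x))"
            using v s0[OF x] by (simp add: lift_on_def Infty)
        qed
        then show ?thesis using s(1) by blast
      qed
    qed
  qed
qed

lemma meromorphic_at_of_lift:
  assumes "r > 0" "lift_on (ball (finite_part z) r) (\<lambda>w. f (chart z w)) v"
    and "w0 \<in> ball (finite_part z) r" "f (chart z w0) \<noteq> Infty"
  shows "meromorphic_at f z"
proof (cases z)
  case (Finite x)
  then show ?thesis using assms meromorphic_at_finite_of_lift[of r x f v w0] by simp
next
  case Infty
  then show ?thesis using assms meromorphic_at_finite_of_lift[of r 0 "f \<circ> sphere_inverse" v w0]
    by (simp add: o_def del: sphere_inverse.simps)
qed

lemma eventually_finite_of_meromorphic_at:
  "meromorphic_at f z \<Longrightarrow> \<forall>\<^sub>F w in at (finite_part z). f (chart z w) \<noteq> Infty"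
  by (cases z) (simp_all add: meromorphic_at_finite_def del: sphere_inverse.simps)

section \<open>From local to global convergence\<close>

definition locally_precompact :: "(riemann_sphere \<Rightarrow> riemann_sphere) set \<Rightarrow> riemann_sphere \<Rightarrow> real \<Rightarrow> bool" where
  "locally_precompact F z s \<longleftrightarrow>
     (\<forall>h. (\<forall>n. h n \<in> F) \<longrightarrow>
        (\<exists>k g. strict_mono (k :: nat \<Rightarrow> nat) \<and> holomorphic_to_sphere (ball (finite_part z) s) g \<and>
               uniform_limit (ball (finite_part z) s) (\<lambda>n w. h (k n) (chart z w)) g sequentially))"

text \<open>Lindelof's theorem in the complex plane; the point \<open>Infty\<close> requires at most one further member of the cover.\<close>

lemma countable_subcover:
  fixes U :: "riemann_sphere \<Rightarrow> riemann_sphere set"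
  assumes "\<And>z. z \<in> D \<Longrightarrow> open (U z) \<and> z \<in> U z"
  obtains T where "T \<subseteq> D" "countable T" "D \<subseteq> (\<Union>z\<in>T. U z)"
proof -
  define G where "G = (\<lambda>z. Finite -` U z) ` D"
  have "open S" if "S \<in> G" for S
    using that assms continuous_on_open_vimage[of UNIV Finite] continuous_on_Finite by (auto simp: G_def)
  then obtain G' where G': "G' \<subseteq> G" "countable G'" "\<Union>G' = \<Union>G" using Lindelof by metis
  then obtain T where T: "T \<subseteq> D" "countable T" "G' = (\<lambda>z. Finite -` U z) ` T"
    unfolding G_def by (metis countable_image_eq subset_image_iff countable_subset_image)
  have "D \<subseteq> (\<Union>z\<in>T \<union> (D \<inter> {Infty}). U z)"
  proof
    fix x assume x: "x \<in> D"
    show "x \<in> (\<Union>z\<in>T \<union> (D \<inter> {Infty}). U z)"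
    proof (cases x)
      case (Finite w)
      then have "w \<in> \<Union>G" using assms[OF x] x by (auto simp: G_def)
      then show ?thesis using G'(3) T(3) Finite by auto
    qed (use x assms[OF x] in auto)
  qed
  then show ?thesis using T by (intro that[of "T \<union> (D \<inter> {Infty})"]) auto
qed

text \<open>The interior of the set where \<open>g\<close> is \<open>Infty\<close> has an open complement in \<open>D\<close>: outside it \<open>g\<close> is meromorphic and
thus finite in a punctured neighbourhood. Connectedness decides between the two.\<close>

lemma identically_Infty_or_meromorphic:
  assumes D: "open D" "connected D"
    and lift: "\<And>z. z \<in> D \<Longrightarrow> \<exists>s>0. \<exists>v. lift_on (ball (finite_part z) s) (\<lambda>w. g (chart z w)) v"
  shows "g \<in> meromorphic_maps D \<union> infinity_maps D"
proof -
  define A where "A = interior {x. g x = Infty}"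
  define B where "B = interior {x. x \<notin> A}"
  have mero: "meromorphic_at g z" if z: "z \<in> D" "z \<notin> A" for z
  proof -
    obtain s v where s: "s > 0" "lift_on (ball (finite_part z) s) (\<lambda>w. g (chart z w)) v" using lift z(1) by blast
    have "\<not> chart z ` ball (finite_part z) s \<subseteq> {x. g x = Infty}"
    proof
      assume "chart z ` ball (finite_part z) s \<subseteq> {x. g x = Infty}"
      moreover have "z \<in> chart z ` ball (finite_part z) s"
        using s(1) by (intro image_eqI[of _ _ "finite_part z"]) auto
      ultimately show False using z(2) open_image_chart[OF open_ball] unfolding A_def by (meson interiorI)
    qed
    then obtain w0 where "w0 \<in> ball (finite_part z) s" "g (chart z w0) \<noteq> Infty" by blast
    with s show ?thesis by (rule meromorphic_at_of_lift)
  qed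
  have cover: "z \<in> A \<union> B" if z: "z \<in> D" for z
  proof (cases "z \<in> A")
    case False
    obtain e where e: "e > 0" "\<And>w. w \<in> ball (finite_part z) e \<Longrightarrow> w \<noteq> finite_part z \<Longrightarrow> g (chart z w) \<noteq> Infty"
      using eventually_finite_of_meromorphic_at[OF mero[OF z False]]
      unfolding eventually_at by (auto simp: dist_commute)
    have "chart z w \<notin> A" if w: "w \<in> ball (finite_part z) e" for w
    proof (cases "w = finite_part z")
      case True
      then show ?thesis using False by simp
    next
      case w': False
      then show ?thesis using e(2)[OF w w'] interior_subset unfolding A_def by blast
    qed
    then have "chart z ` ball (finite_part z) e \<subseteq> {x. x \<notin> A}" by auto
    moreover have "z \<in> chart z ` ball (finite_part z) e"
      using e(1) by (intro image_eqI[of _ _ "finite_part z"]) auto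
    ultimately show ?thesis using open_image_chart[OF open_ball] unfolding B_def by (meson UnI2 interiorI)
  qed auto
  have "open A" "open B" by (auto simp: A_def B_def)
  moreover have "A \<inter> B = {}" using interior_subset[of "{x. x \<notin> A}"] by (auto simp: B_def)
  ultimately have "A \<inter> D = {} \<or> B \<inter> D = {}"
    using connectedD[OF D(2)] cover by blast
  then show ?thesis
  proof
    assume "A \<inter> D = {}"
    then show ?thesis using mero by (auto simp: meromorphic_maps_def)
  next
    assume "B \<inter> D = {}"
    then have "D \<subseteq> A" using cover by blast
    then show ?thesis using interior_subset[of "{x. g x = Infty}"] by (auto simp: A_def infinity_maps_def)
  qed
qed

text \<open>A diagonal sequence converges uniformly on each of countably many chart discs that cover \<open>D\<close>. At an arbitrary point of \<open>D\<close>,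
which need not be a centre of one of them, a lift of the limit is obtained by applying precompactness there once
more to the diagonal sequence.\<close>

lemma normal_family_of_locally_precompact:
  assumes D: "sphere_domain D"
    and loc: "\<And>z. z \<in> D \<Longrightarrow> \<exists>s>0. chart z ` ball (finite_part z) s \<subseteq> D \<and> locally_precompact F z s"
  shows "normal_family F D"
  unfolding normal_family_def
proof (intro allI impI)
  fix h :: "nat \<Rightarrow> riemann_sphere \<Rightarrow> riemann_sphere" assume h: "\<forall>n. h n \<in> F"
  obtain s where s: "\<And>z. z \<in> D \<Longrightarrow> s z > 0" "\<And>z. z \<in> D \<Longrightarrow> chart z ` ball (finite_part z) (s z) \<subseteq> D"
    "\<And>z. z \<in> D \<Longrightarrow> locally_precompact F z (s z)" using loc by metis
  define U where "U = (\<lambda>z. chart z ` ball (finite_part z) (s z))"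
  have U: "open (U z) \<and> z \<in> U z" if "z \<in> D" for z
    unfolding U_def using s(1)[OF that]
    by (intro conjI open_image_chart open_ball image_eqI[of _ _ "finite_part z"]) auto
  obtain T where T: "T \<subseteq> D" "countable T" "D \<subseteq> (\<Union>z\<in>T. U z)" using countable_subcover[OF U] .
  have "T \<noteq> {}" using T D by (auto simp: sphere_domain_def)
  then obtain \<sigma> :: "nat \<Rightarrow> riemann_sphere" where \<sigma>: "T = range \<sigma>"
    using T(2) uncountable_def by blast
  define P where "P = (\<lambda>i (r :: nat \<Rightarrow> nat). \<exists>g. uniform_limit (U (\<sigma> i)) (\<lambda>n. h (r n)) g sequentially)"
  obtain k where k: "strict_mono (k :: nat \<Rightarrow> nat)" "\<And>i. P i (id \<circ> k)"
  proof (rule subsequence_diagonalization_lemma[of P id])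
    fix i and r :: "nat \<Rightarrow> nat"
    have "\<sigma> i \<in> D" using T(1) \<sigma> by auto
    moreover have "\<forall>n. h (r n) \<in> F" using h by simp
    ultimately have "\<exists>k g. strict_mono (k :: nat \<Rightarrow> nat) \<and> holomorphic_to_sphere (ball (finite_part (\<sigma> i)) (s (\<sigma> i))) g \<and>
      uniform_limit (ball (finite_part (\<sigma> i)) (s (\<sigma> i))) (\<lambda>n w. h (r (k n)) (chart (\<sigma> i) w)) g sequentially"
      using s(3)[of "\<sigma> i"] unfolding locally_precompact_def by (elim allE[of _ "\<lambda>n. h (r n)"] meta_impE) simp_all
    then obtain k g where k: "strict_mono (k :: nat \<Rightarrow> nat)"
      "uniform_limit (ball (finite_part (\<sigma> i)) (s (\<sigma> i))) (\<lambda>n w. h (r (k n)) (chart (\<sigma> i) w)) g sequentially"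
      by (elim exE conjE)
    have "uniform_limit (U (\<sigma> i)) (\<lambda>n. h (r (k n)))
        (\<lambda>x. g (inv_into (ball (finite_part (\<sigma> i)) (s (\<sigma> i))) (chart (\<sigma> i)) x)) sequentially"
      unfolding uniform_limit_iff
    proof (intro allI impI)
      fix e :: real assume "e > 0"
      then have "\<forall>\<^sub>F n in sequentially. \<forall>w\<in>ball (finite_part (\<sigma> i)) (s (\<sigma> i)).
          dist (h (r (k n)) (chart (\<sigma> i) w)) (g w) < e" using uniform_limitD[OF k(2)] by blast
      then show "\<forall>\<^sub>F n in sequentially. \<forall>x\<in>U (\<sigma> i). dist (h (r (k n)) x)
         (g (inv_into (ball (finite_part (\<sigma> i)) (s (\<sigma> i))) (chart (\<sigma> i)) x)) < e"
      proof eventually_elim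
        case (elim n)
        show ?case
        proof
          fix x assume x: "x \<in> U (\<sigma> i)"
          then have "inv_into (ball (finite_part (\<sigma> i)) (s (\<sigma> i))) (chart (\<sigma> i)) x \<in> ball (finite_part (\<sigma> i)) (s (\<sigma> i))"
            "chart (\<sigma> i) (inv_into (ball (finite_part (\<sigma> i)) (s (\<sigma> i))) (chart (\<sigma> i)) x) = x"
            unfolding U_def by (auto intro: inv_into_into f_inv_into_f simp del: mem_ball)
          then show "dist (h (r (k n)) x) (g (inv_into (ball (finite_part (\<sigma> i)) (s (\<sigma> i))) (chart (\<sigma> i)) x)) < e"
            using elim by metis
        qed
      qed
    qed
    then show "\<exists>k. strict_mono k \<and> P i (r \<circ> k)" using k(1) unfolding P_def o_def by blast
  next
    fix i and r k1 k2 :: "nat \<Rightarrow> nat" and N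
    assume P1: "P i (r \<circ> k1)" and sub: "\<And>j. N \<le> j \<Longrightarrow> \<exists>j'\<ge>j. k2 j = k1 j'"
    then obtain g where g: "uniform_limit (U (\<sigma> i)) (\<lambda>n. h (r (k1 n))) g sequentially"
      unfolding P_def by auto
    have "uniform_limit (U (\<sigma> i)) (\<lambda>n. h (r (k2 n))) g sequentially"
      unfolding uniform_limit_iff
    proof (intro allI impI)
      fix e :: real assume "e > 0"
      then obtain N' where N': "\<And>n. n \<ge> N' \<Longrightarrow> \<forall>x\<in>U (\<sigma> i). dist (h (r (k1 n)) x) (g x) < e"
        using uniform_limitD[OF g] unfolding eventually_sequentially by meson
      have "\<forall>x\<in>U (\<sigma> i). dist (h (r (k2 n)) x) (g x) < e" if n: "n \<ge> max N N'" for n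
      proof -
        obtain j' where "j' \<ge> n" "k2 n = k1 j'" using sub[of n] n by auto
        then show ?thesis using N'[of j'] n by simp
      qed
      then show "\<forall>\<^sub>F n in sequentially. \<forall>x\<in>U (\<sigma> i). dist (h (r (k2 n)) x) (g x) < e"
        unfolding eventually_sequentially by blast
    qed
    then show "P i (r \<circ> k2)" unfolding P_def by auto
  qed (rule that)
  define G where "G = (\<lambda>x. lim (\<lambda>n. h (k n) x))"
  have ul: "uniform_limit (U (\<sigma> i)) (h \<circ> k) G sequentially" for i
  proof -
    obtain g where g: "uniform_limit (U (\<sigma> i)) (\<lambda>n. h (k n)) g sequentially"
      using k(2)[of i] unfolding P_def by auto
    have "G x = g x" if "x \<in> U (\<sigma> i)" for x
      unfolding G_def using tendsto_uniform_limitI[OF g that] by (rule limI)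
    with g show ?thesis by (simp add: uniform_limit_iff)
  qed
  have idx: "\<exists>i. z \<in> U (\<sigma> i)" if "z \<in> D" for z using T(3) that \<sigma> by auto
  have UD: "U (\<sigma> i) \<subseteq> D" "open (U (\<sigma> i))" for i
  proof -
    have "\<sigma> i \<in> D" using T(1) \<sigma> by auto
    then show "U (\<sigma> i) \<subseteq> D" "open (U (\<sigma> i))" using s(2) U by (auto simp: U_def)
  qed
  have "locally_uniform_limit D (h \<circ> k) G"
    unfolding locally_uniform_limit_def
  proof
    fix z assume "z \<in> D"
    then obtain i where "z \<in> U (\<sigma> i)" using idx by blast
    then show "\<exists>V. open V \<and> z \<in> V \<and> V \<subseteq> D \<and> uniform_limit V (h \<circ> k) G sequentially"
      by (intro exI[of _ "U (\<sigma> i)"] conjI UD ul)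
  qed
  moreover have "G \<in> meromorphic_maps D \<union> infinity_maps D"
  proof (rule identically_Infty_or_meromorphic)
    show "open D" "connected D" using D by (auto simp: sphere_domain_def)
    fix z assume z: "z \<in> D"
    let ?B = "ball (finite_part z) (s z)"
    have "\<forall>n. h (k n) \<in> F" using h by simp
    with s(3)[OF z] have "\<exists>k' g. strict_mono (k' :: nat \<Rightarrow> nat) \<and> holomorphic_to_sphere ?B g \<and>
        uniform_limit ?B (\<lambda>n w. h (k (k' n)) (chart z w)) g sequentially"
      unfolding locally_precompact_def by (elim allE[of _ "\<lambda>n. h (k n)"]) simp
    then obtain k' g where k': "strict_mono (k' :: nat \<Rightarrow> nat)" and hol: "holomorphic_to_sphere ?B g"
      and lim: "uniform_limit ?B (\<lambda>n w. h (k (k' n)) (chart z w)) g sequentially"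
      by (elim exE conjE)
    have eq: "G (chart z w) = g w" if w: "w \<in> ?B" for w
    proof -
      have "chart z w \<in> D" using s(2)[OF z] w by blast
      then obtain i where "chart z w \<in> U (\<sigma> i)" using idx by blast
      from tendsto_uniform_limitI[OF ul this] have "(\<lambda>n. h (k n) (chart z w)) \<longlonglongrightarrow> G (chart z w)"
        by simp
      from LIMSEQ_subseq_LIMSEQ[OF this k'] have "(\<lambda>n. h (k (k' n)) (chart z w)) \<longlonglongrightarrow> G (chart z w)"
        by (simp add: o_def)
      moreover have "(\<lambda>n. h (k (k' n)) (chart z w)) \<longlonglongrightarrow> g w"
        using tendsto_uniform_limitI[OF lim w] .
      ultimately show ?thesis using LIMSEQ_unique by blast
    qed
    have "finite_part z \<in> ?B" using s(1)[OF z] by simp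
    then obtain r v where r: "r > 0" "lift_on (ball (finite_part z) r) g v"
      using hol unfolding holomorphic_to_sphere_def by blast
    have "lift_on (ball (finite_part z) (min r (s z))) g v"
      by (rule lift_on_subset[OF r(2)]) auto
    then have "lift_on (ball (finite_part z) (min r (s z))) (\<lambda>w. G (chart z w)) v"
      using eq unfolding lift_on_def by auto
    then show "\<exists>s>0. \<exists>v. lift_on (ball (finite_part z) s) (\<lambda>w. G (chart z w)) v"
      using r(1) s(1)[OF z] by (intro exI[of _ "min r (s z)"]) auto
  qed
  ultimately show "\<exists>r g. strict_mono (r :: nat \<Rightarrow> nat) \<and> g \<in> meromorphic_maps D \<union> infinity_maps D \<and>
      locally_uniform_limit D (h \<circ> r) g" using k(1) by blast
qed

section \<open>Normality of families sharing three wandering functions\<close>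

theorem theorem1p1:
  fixes D :: "riemann_sphere set"
    and F :: "(riemann_sphere \<Rightarrow> riemann_sphere) set"
    and \<epsilon> :: real
    and a :: "nat \<Rightarrow> (riemann_sphere \<Rightarrow> riemann_sphere) \<Rightarrow> riemann_sphere \<Rightarrow> riemann_sphere"
  assumes "sphere_domain D"
    and "F \<subseteq> meromorphic_maps D"
    and "\<epsilon> > 0"
    and "\<And>f j. f \<in> F \<Longrightarrow> j \<in> {1, 2, 3} \<Longrightarrow> a j f \<in> meromorphic_maps D \<union> infinity_maps D"
    and "\<And>f j k z. f \<in> F \<Longrightarrow> j \<in> {1, 2, 3} \<Longrightarrow> k \<in> {1, 2, 3} \<Longrightarrow> j \<noteq> k \<Longrightarrow> z \<in> D \<Longrightarrow>
           dist (a j f z) (a k f z) \<ge> \<epsilon>"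
    and "\<And>f g j. f \<in> F \<Longrightarrow> g \<in> F \<Longrightarrow> j \<in> {1, 2, 3} \<Longrightarrow> share_zero D f (a j f) g (a j g)"
  shows "normal_family F D"
proof (rule normal_family_of_locally_precompact[OF assms(1)])
  fix z assume z: "z \<in> D"
  define c where "c = finite_part z"
  have "open (chart z -` D)"
    using assms(1) continuous_on_open_vimage[of UNIV "chart z"] continuous_on_chart by (auto simp: sphere_domain_def)
  moreover have "c \<in> chart z -` D" using z by (simp add: c_def)
  ultimately obtain R where R: "R > 0" "ball c R \<subseteq> chart z -` D" by (meson open_contains_ball)
  have RD: "chart z ` ball c R \<subseteq> D" using R(2) by blast
  note hol = holomorphic_to_sphere_chart[OF _ open_ball RD]
  have share: "f (chart z w) = a j f (chart z w) \<longleftrightarrow> g (chart z w) = a j g (chart z w)"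
    if "f \<in> F" "g \<in> F" "w \<in> ball c R" "j \<in> {1, 2, 3}" for f g w j
  proof -
    have "chart z w \<in> D" using RD that(3) by blast
    then show ?thesis using assms(6)[OF that(1,2,4)] unfolding share_zero_def by blast
  qed
  have "\<exists>\<rho>>0. \<exists>M. \<exists>m>0. \<forall>f\<in>F. bounded_lift M m (ball c \<rho>) (\<lambda>w. f (chart z w))"
  proof (rule locally_uniformly_liftable[OF R(1) assms(3)])
    fix f assume f: "f \<in> F"
    show "holomorphic_to_sphere (ball c R) (\<lambda>w. f (chart z w))" using f assms(2) by (intro hol) auto
    show "separated_triple \<epsilon> (ball c R) (\<lambda>w. a 1 f (chart z w)) (\<lambda>w. a 2 f (chart z w)) (\<lambda>w. a 3 f (chart z w))"
      unfolding separated_triple_def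
    proof (intro conjI ballI)
      show "holomorphic_to_sphere (ball c R) (\<lambda>w. a 1 f (chart z w))"
        "holomorphic_to_sphere (ball c R) (\<lambda>w. a 2 f (chart z w))"
        "holomorphic_to_sphere (ball c R) (\<lambda>w. a 3 f (chart z w))"
        by (rule hol, rule assms(4)[OF f], simp)+
      fix w assume "w \<in> ball c R"
      then have "chart z w \<in> D" using RD by blast
      then show "\<epsilon> \<le> dist (a 1 f (chart z w)) (a 2 f (chart z w))"
        "\<epsilon> \<le> dist (a 1 f (chart z w)) (a 3 f (chart z w))"
        "\<epsilon> \<le> dist (a 2 f (chart z w)) (a 3 f (chart z w))"
        using assms(5)[OF f, of 1 2 "chart z w"] assms(5)[OF f, of 1 3 "chart z w"]
          assms(5)[OF f, of 2 3 "chart z w"] by simp_all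
    qed
  qed (rule share; simp)+
  then obtain \<rho> M m where \<rho>: "\<rho> > 0" "m > 0"
    and bl: "\<And>f. f \<in> F \<Longrightarrow> bounded_lift M m (ball c \<rho>) (\<lambda>w. f (chart z w))" by blast
  define s where "s = min \<rho> R"
  have s: "s > 0" using \<rho> R by (simp add: s_def)
  have "locally_precompact F z (s/2)"
    unfolding locally_precompact_def
  proof (intro allI impI)
    fix h :: "nat \<Rightarrow> riemann_sphere \<Rightarrow> riemann_sphere" assume h: "\<forall>n. h n \<in> F"
    have "bounded_lift M m (ball c s) (\<lambda>w. h n (chart z w))" for n
      by (rule bounded_lift_subset[OF bl]) (use h in \<open>auto simp: s_def\<close>)
    from uniform_subsequence_of_bounded_lifts[where u = "\<lambda>n w. h n (chart z w)", OF s \<rho>(2) this]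
    obtain k g where k: "strict_mono (k :: nat \<Rightarrow> nat)" "holomorphic_to_sphere (ball c s) g"
      "uniform_limit (ball c (s/2)) (\<lambda>n w. h (k n) (chart z w)) g sequentially" by metis
    have "holomorphic_to_sphere (ball c (s/2)) g"
      using k(2) by (rule holomorphic_to_sphere_subset) (use s in auto)
    with k show "\<exists>k g. strict_mono (k :: nat \<Rightarrow> nat) \<and> holomorphic_to_sphere (ball (finite_part z) (s/2)) g \<and>
               uniform_limit (ball (finite_part z) (s/2)) (\<lambda>n w. h (k n) (chart z w)) g sequentially"
      unfolding c_def by blast
  qed
  moreover have "chart z ` ball c (s/2) \<subseteq> D"
  proof -
    have "ball c (s/2) \<subseteq> ball c R" using s by (auto simp: s_def)
    then show ?thesis using RD by blast
  qed
  ultimately show "\<exists>s>0. chart z ` ball (finite_part z) s \<subseteq> D \<and> locally_precompact F z s"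
    using s unfolding c_def by (intro exI[of _ "s/2"]) auto
qed

end
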